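(* Let $p$ be a prime, let $G$ be a finite $p$-group of nilpotency class $2$ and let $w$ be a word in $k$ variables. Then $N_{w,G}(1)\geq |G|^{k-1}$.
   Context: Here a word in the $k$ variables $x_1,\dots,x_k$ ($k\ge 1$) is an element $w$ of $F_k$, the free pro-$p$ group of nilpotency class $2$ on $x_1,\dots,x_k$. Every $w\in F_k$ can be written uniquely as $w=x_1^{z_1}\cdots x_k^{z_k}\prod_{1\le i<j\le k}[x_i,x_j]^{z_{ij}}$ with $p$-adic integer exponents $z_l,z_{ij}\in\mathbb{Z}_p$. For $g_1,\dots,g_k\in G$, $w(g_1,\dots,g_k)\in G$ denotes the image of $w$ under the (continuous) homomorphism $F_k\to G$ with $x_i\mapsto g_i$. For $g\in G$, $N_{w,G}(g)=|\{(g_1,\dots,g_k)\in G^{k}\mid w(g_1,\dots,g_k)=g\}|$. *)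

theory Defs
  imports "HOL-Algebra.Generated_Groups" "HOL-Analysis.Analysis"
begin

text \<open>\<open>lower_central G n\<close> is the term usually written \<open>\<gamma>\<close> with index \<open>n + 1\<close>, so that the
  group has class at most \<open>c\<close> iff \<open>lower_central G c\<close> is trivial.\<close>

primrec lower_central :: "('a, 'b) monoid_scheme \<Rightarrow> nat \<Rightarrow> 'a set" where
  "lower_central G 0 = carrier G"
| "lower_central G (Suc n) = generate G
     (\<Union>a \<in> lower_central G n. \<Union>b \<in> carrier G. {a \<otimes>\<^bsub>G\<^esub> b \<otimes>\<^bsub>G\<^esub> inv\<^bsub>G\<^esub> a \<otimes>\<^bsub>G\<^esub> inv\<^bsub>G\<^esub> b})"

definition nilpotency_class_le :: "('a, 'b) monoid_scheme \<Rightarrow> nat \<Rightarrow> bool" where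
  "nilpotency_class_le G c \<longleftrightarrow> lower_central G c = {\<one>\<^bsub>G\<^esub>}"

definition has_nilpotency_class :: "('a, 'b) monoid_scheme \<Rightarrow> nat \<Rightarrow> bool" where
  "has_nilpotency_class G c \<longleftrightarrow>
     nilpotency_class_le G c \<and> (\<forall>d<c. \<not> nilpotency_class_le G d)"

definition finite_p_group :: "nat \<Rightarrow> ('a, 'b) monoid_scheme \<Rightarrow> bool" where
  "finite_p_group p G \<longleftrightarrow> group G \<and> finite (carrier G) \<and> (\<exists>n. card (carrier G) = p ^ n)"

definition topological_group :: "('a, 'b) monoid_scheme \<Rightarrow> 'a topology \<Rightarrow> bool" where
  "topological_group F T \<longleftrightarrow>
     group F \<and> topspace T = carrier F \<and>
     continuous_map (prod_topology T T) T (\<lambda>(a, b). a \<otimes>\<^bsub>F\<^esub> b) \<and>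
     continuous_map T T (\<lambda>a. inv\<^bsub>F\<^esub> a)"

definition pro_p_group :: "nat \<Rightarrow> ('a, 'b) monoid_scheme \<Rightarrow> 'a topology \<Rightarrow> bool" where
  "pro_p_group p F T \<longleftrightarrow>
     topological_group F T \<and> compact_space T \<and> Hausdorff_space T \<and>
     (\<forall>U. openin T U \<and> \<one>\<^bsub>F\<^esub> \<in> U \<longrightarrow>
        (\<exists>N. N \<lhd> F \<and> openin T N \<and> N \<subseteq> U \<and> finite_p_group p (F Mod N)))"

text \<open>Continuous homomorphisms into a (finite) discrete group; requiring extensionality makes
  two of them equal as HOL functions as soon as they agree on the carrier.\<close>

definition continuous_homs ::
    "('a, 'b) monoid_scheme \<Rightarrow> 'a topology \<Rightarrow> ('c, 'd) monoid_scheme \<Rightarrow> ('a \<Rightarrow> 'c) set" where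
  "continuous_homs F T G =
     {\<phi> \<in> hom F G \<inter> extensional (carrier F).
        continuous_map T (discrete_topology (carrier G)) \<phi>}"

text \<open>\<open>F\<close> with topology \<open>T\<close> is the free pro-\<open>p\<close> group of nilpotency class 2 on
  \<open>x 0, \<dots>, x (k - 1)\<close>, i.e. the free object among pro-\<open>p\<close> groups of class at most 2 (for
  \<open>k = 1\<close> it is abelian).  As usual for free pro-\<open>\<C>\<close> groups, the universal property is required
  for finite test groups; it passes to their inverse limits.  Every finite group has an
  isomorphic copy with carrier in \<^typ>\<open>nat\<close>, so it is enough to quantify over those.
  The homomorphism is unique because the \<open>x i\<close> generate \<open>F\<close> topologically.\<close>

definition free_pro_p_group_class2 ::
    "nat \<Rightarrow> nat \<Rightarrow> ('a, 'b) monoid_scheme \<Rightarrow> 'a topology \<Rightarrow> (nat \<Rightarrow> 'a) \<Rightarrow> bool" where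
  "free_pro_p_group_class2 p k F T x \<longleftrightarrow>
     pro_p_group p F T \<and> nilpotency_class_le F 2 \<and>
     x ` {..<k} \<subseteq> carrier F \<and>
     Abstract_Topology.closure_of T (generate F (x ` {..<k})) = carrier F \<and>
     (\<forall>(H :: nat monoid) h.
        finite_p_group p H \<and> nilpotency_class_le H 2 \<and> h ` {..<k} \<subseteq> carrier H \<longrightarrow>
        (\<exists>\<phi> \<in> continuous_homs F T H. \<forall>i<k. \<phi> (x i) = h i))"

definition word_value ::
    "nat \<Rightarrow> ('f, 'e) monoid_scheme \<Rightarrow> 'f topology \<Rightarrow> (nat \<Rightarrow> 'f) \<Rightarrow> 'f \<Rightarrow>
     ('a, 'b) monoid_scheme \<Rightarrow> (nat \<Rightarrow> 'a) \<Rightarrow> 'a" where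
  "word_value k F T x w G g =
     (THE \<phi>. \<phi> \<in> continuous_homs F T G \<and> (\<forall>i<k. \<phi> (x i) = g i)) w"

definition word_count ::
    "nat \<Rightarrow> ('f, 'e) monoid_scheme \<Rightarrow> 'f topology \<Rightarrow> (nat \<Rightarrow> 'f) \<Rightarrow> 'f \<Rightarrow>
     ('a, 'b) monoid_scheme \<Rightarrow> 'a \<Rightarrow> nat" where
  "word_count k F T x w G a =
     card {g \<in> {..<k} \<rightarrow>\<^sub>E carrier G. word_value k F T x w G g = a}"

end

theory Submission
  imports Defs "HOL-Algebra.Product_Groups" "HOL-Algebra.Weak_Morphisms"
begin

text \<open>Since \<open>G\<close> is finite and the \<open>x i\<close> generate \<open>F\<close> topologically, \<open>w\<close> may be replaced by an abstract
  word in the \<open>x i\<close>. An invertible change of variables, which permutes the tuples over \<open>G\<close>, runs the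
  Euclidean algorithm on exponents and brings this word to the form \<open>g 0 [^] m \<otimes> c g\<close> with \<open>c\<close> a product
  of powers of the commutators \<open>[g i, g (i + 1)]\<close>. As no commutator of two coordinates of the same
  parity occurs, \<open>c\<close> is a homomorphism in the even coordinates when the odd ones are frozen, and it
  does not see a central value of \<open>g 0\<close>. For fixed odd coordinates, let \<open>A\<close> be the image of this
  homomorphism \<open>h\<close> on the \<open>r\<close> remaining even coordinates: choosing \<open>g 0 = a \<in> A\<close> and then a
  preimage of \<open>a\<close> to the power \<open>-m\<close> under \<open>h\<close> already gives \<open>card A\<close> times the size of the kernel of
  \<open>h\<close>, that is \<open>card (carrier G) ^ r\<close>, solutions.\<close>

section \<open>Groups of class 2\<close>

definition commutator :: "('a, 'b) monoid_scheme \<Rightarrow> 'a \<Rightarrow> 'a \<Rightarrow> 'a" where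
  "commutator G x y = x \<otimes>\<^bsub>G\<^esub> y \<otimes>\<^bsub>G\<^esub> inv\<^bsub>G\<^esub> x \<otimes>\<^bsub>G\<^esub> inv\<^bsub>G\<^esub> y"

text \<open>In class 2, and for \<open>S\<close> inside the carrier, this is the derived subgroup of
  \<open>generate G S\<close>. Using only commutators of elements of \<open>S\<close> reduces later
  arguments to pairs of generators.\<close>

definition commutators :: "('a, 'b) monoid_scheme \<Rightarrow> 'a set \<Rightarrow> 'a set" where
  "commutators G S = generate G {commutator G x y | x y. x \<in> S \<and> y \<in> S}"

lemma (in group) commutator_closed [simp, intro]:
  "x \<in> carrier G \<Longrightarrow> y \<in> carrier G \<Longrightarrow> commutator G x y \<in> carrier G"
  by (simp add: commutator_def)

lemma (in group) inv_mult_cancel: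
  assumes "x \<in> carrier G" "y \<in> carrier G"
  shows "inv x \<otimes> (x \<otimes> y) = y" "x \<otimes> (inv x \<otimes> y) = y"
  using assms by (simp_all add: m_assoc[symmetric])

lemma (in group) commutator_eq_one:
  assumes "x \<in> carrier G" "y \<in> carrier G" "x \<otimes> y = y \<otimes> x"
  shows "commutator G x y = \<one>"
  using assms(1,2) unfolding commutator_def assms(3) by (simp add: m_assoc inv_mult_cancel)

lemma (in group) commutator_mult:
  assumes "x \<in> carrier G" "y \<in> carrier G"
  shows "commutator G x y \<otimes> (y \<otimes> x) = x \<otimes> y"
  using assms by (simp add: commutator_def m_assoc inv_mult_cancel)

lemma (in group) commutator_eqI:
  assumes "x \<in> carrier G" "y \<in> carrier G" "z \<in> carrier G" "z \<otimes> (y \<otimes> x) = x \<otimes> y"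
  shows "commutator G x y = z"
  using assms by (metis commutator_closed commutator_mult m_closed right_cancel)

lemma (in group_hom) hom_commutator:
  assumes "x \<in> carrier G" "y \<in> carrier G"
  shows "h (commutator G x y) = commutator H (h x) (h y)"
  using assms by (simp add: commutator_def)

text \<open>Class at most 2, put as an identity between elements, so that it can be checked
  pointwise in a group of functions.\<close>

locale class2_group = group +
  assumes commutator_central:
    "\<lbrakk>x \<in> carrier G; y \<in> carrier G; z \<in> carrier G\<rbrakk> \<Longrightarrow>
      commutator G x y \<otimes> z = z \<otimes> commutator G x y"
begin

text \<open>By \<open>commutator_eqI\<close> it suffices to move \<open>z\<close> to the right
  through \<open>x \<otimes> y\<close>. It passes \<open>x\<close> first and \<open>y\<close>
  afterwards, absorbing a commutator each time; the second commutator is central and can wait for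
  its turn.\<close>

lemma commutator_mult_left:
  assumes [simp]: "x \<in> carrier G" "y \<in> carrier G" "z \<in> carrier G"
  shows "commutator G (x \<otimes> y) z = commutator G x z \<otimes> commutator G y z"
proof (rule commutator_eqI)
  have "commutator G x z \<otimes> commutator G y z \<otimes> (z \<otimes> (x \<otimes> y))
      = commutator G x z \<otimes> (commutator G y z \<otimes> (z \<otimes> x)) \<otimes> y"
    by (simp add: m_assoc)
  also have "\<dots> = commutator G x z \<otimes> (z \<otimes> x) \<otimes> commutator G y z \<otimes> y"
    by (subst commutator_central) (auto simp: m_assoc)
  also have "\<dots> = x \<otimes> (commutator G y z \<otimes> (z \<otimes> y))"
    by (subst commutator_mult) (auto simp: commutator_central[of y z] m_assoc)
  also have "\<dots> = x \<otimes> y \<otimes> z"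
    by (simp add: commutator_mult m_assoc)
  finally show "commutator G x z \<otimes> commutator G y z \<otimes> (z \<otimes> (x \<otimes> y)) = x \<otimes> y \<otimes> z" .
qed auto

lemma commutator_swap:
  assumes [simp]: "x \<in> carrier G" "y \<in> carrier G"
  shows "commutator G x y = inv (commutator G y x)"
  by (simp add: commutator_def inv_mult_group m_assoc)

lemma commutator_mult_right:
  assumes [simp]: "x \<in> carrier G" "y \<in> carrier G" "z \<in> carrier G"
  shows "commutator G x (y \<otimes> z) = commutator G x y \<otimes> commutator G x z"
proof -
  have "commutator G x (y \<otimes> z) = inv (commutator G z x) \<otimes> inv (commutator G y x)"
    by (simp add: commutator_swap[of x "y \<otimes> z"] commutator_mult_left inv_mult_group)
  also have "\<dots> = commutator G x z \<otimes> commutator G x y"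
    by (simp flip: commutator_swap)
  finally show ?thesis
    using commutator_central[of x z "commutator G x y"] by simp
qed

lemma commutator_hom_left:
  "z \<in> carrier G \<Longrightarrow> (\<lambda>x. commutator G x z) \<in> hom G G"
  by (rule homI) (auto simp: commutator_mult_left)

lemma commutator_hom_right:
  "z \<in> carrier G \<Longrightarrow> commutator G z \<in> hom G G"
  by (rule homI) (auto simp: commutator_mult_right)

lemma commutator_inv_left:
  "\<lbrakk>x \<in> carrier G; z \<in> carrier G\<rbrakk> \<Longrightarrow> commutator G (inv x) z = inv (commutator G x z)"
  using group_hom.hom_inv[of G G "\<lambda>x. commutator G x z" x] commutator_hom_left
  by (simp add: group_hom_def group_hom_axioms_def is_group)

lemma commutator_inv_right:
  "\<lbrakk>x \<in> carrier G; z \<in> carrier G\<rbrakk> \<Longrightarrow> commutator G z (inv x) = inv (commutator G z x)"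
  using group_hom.hom_inv[of G G "commutator G z" x] commutator_hom_right
  by (simp add: group_hom_def group_hom_axioms_def is_group)

lemma commutator_int_pow_right:
  "\<lbrakk>x \<in> carrier G; z \<in> carrier G\<rbrakk> \<Longrightarrow>
    commutator G z (x [^] (n::int)) = commutator G z x [^] n"
  using group_hom.hom_int_pow[of G G "commutator G z" x n] commutator_hom_right
  by (simp add: group_hom_def group_hom_axioms_def is_group)

section \<open>The subgroup generated by the commutators of a set\<close>

lemma commutators_closed:
  assumes "S \<subseteq> carrier G" "d \<in> commutators G S"
  shows "d \<in> carrier G"
  using assms unfolding commutators_def by (elim generate_in_carrier[rotated]) auto

lemma generate_central:
  assumes "S \<subseteq> carrier G" "\<And>s. s \<in> S \<Longrightarrow> s \<otimes> z = z \<otimes> s" "z \<in> carrier G" "d \<in> generate G S"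
  shows "d \<otimes> z = z \<otimes> d"
  using assms(4)
proof induction
  case one
  show ?case using assms(3) by simp
next
  case (incl h)
  then show ?case by (rule assms(2))
next
  case (inv h)
  then have h: "h \<in> carrier G" "h \<otimes> z = z \<otimes> h" using assms by auto
  then have "inv h \<otimes> z = inv h \<otimes> (z \<otimes> h) \<otimes> inv h"
    using assms(3) by (simp add: m_assoc)
  also have "\<dots> = inv h \<otimes> (h \<otimes> z) \<otimes> inv h"
    by (simp add: h)
  also have "\<dots> = z \<otimes> inv h"
    using assms(3) h(1) by (simp add: m_assoc[symmetric])
  finally show ?case .
next
  case (eng h1 h2)
  then have h: "h1 \<in> carrier G" "h2 \<in> carrier G" using assms(1) generate_in_carrier by auto
  then have "h1 \<otimes> h2 \<otimes> z = h1 \<otimes> z \<otimes> h2"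
    using assms(3) eng.IH(2) by (simp add: m_assoc)
  then show ?case using assms(3) eng.IH(1) h by (simp add: m_assoc)
qed

lemma commutators_central:
  assumes "S \<subseteq> carrier G" "d \<in> commutators G S" "z \<in> carrier G"
  shows "d \<otimes> z = z \<otimes> d"
proof (rule generate_central[OF _ _ assms(3) assms(2)[unfolded commutators_def]])
  fix s assume "s \<in> {commutator G x y |x y. x \<in> S \<and> y \<in> S}"
  then show "s \<otimes> z = z \<otimes> s"
    using assms(1,3) commutator_central by blast
qed (use assms(1) in auto)

lemma commutators_mult:
  "\<lbrakk>d \<in> commutators G S; e \<in> commutators G S\<rbrakk> \<Longrightarrow> d \<otimes> e \<in> commutators G S"
  by (simp add: commutators_def generate.eng)

lemma commutators_one: "\<one> \<in> commutators G S"
  by (simp add: commutators_def generate.one)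

lemma commutators_inv:
  assumes "S \<subseteq> carrier G" "d \<in> commutators G S"
  shows "inv d \<in> commutators G S"
  using assms unfolding commutators_def by (intro generate_m_inv_closed) auto

lemma commutators_mono: "S \<subseteq> S' \<Longrightarrow> commutators G S \<subseteq> commutators G S'"
  unfolding commutators_def by (rule mono_generate) auto

text \<open>Follows from bilinearity by two inductions: first on \<open>v\<close> against a single
  generator \<open>s\<close>, then on \<open>u\<close> against the fixed \<open>v\<close>.\<close>

lemma commutator_in_commutators:
  assumes S: "S \<subseteq> carrier G" and u: "u \<in> generate G S" and v: "v \<in> generate G S"
  shows "commutator G u v \<in> commutators G S"
proof -
  have sv: "commutator G s v \<in> commutators G S" if s: "s \<in> S" for s
    using v
  proof induction
    case one
    then show ?case using S s by (simp add: commutator_eq_one commutators_one subset_iff)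
  next
    case (incl h)
    then show ?case using s unfolding commutators_def by (intro generate.incl) auto
  next
    case (inv h)
    then have "commutator G s (inv h) = inv (commutator G s h)"
      using S s by (simp add: commutator_inv_right subset_iff)
    then show ?case using s inv unfolding commutators_def by (auto intro: generate.inv)
  next
    case (eng h1 h2)
    then show ?case using S s generate_in_carrier[OF S]
      by (simp add: commutator_mult_right commutators_mult subset_iff)
  qed
  have vc: "v \<in> carrier G" using generate_in_carrier S v by auto
  show ?thesis
    using u
  proof induction
    case one
    then show ?case using vc by (simp add: commutator_eq_one commutators_one)
  next
    case (inv h)
    then show ?case using S vc by (simp add: commutator_inv_left subset_iff commutators_inv sv)
  next
    case (eng h1 h2)
    then show ?case using vc generate_in_carrier[OF S]
      by (simp add: commutator_mult_left commutators_mult)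
  qed (rule sv)
qed

section \<open>Collecting generators modulo commutators\<close>

lemma generate_swap:
  assumes "S \<subseteq> carrier G" "u \<in> generate G S" "v \<in> generate G S"
  obtains d where "d \<in> commutators G S" "u \<otimes> v = v \<otimes> u \<otimes> d"
proof
  show "commutator G u v \<in> commutators G S"
    using assms by (rule commutator_in_commutators)
  show "u \<otimes> v = v \<otimes> u \<otimes> commutator G u v"
    using assms generate_in_carrier commutator_mult commutator_central by (metis m_closed)
qed

text \<open>Modulo the central subgroup \<open>commutators G S\<close> the group
  \<open>generate G S\<close> is abelian, so the power law holds up to a correction. The correction
  is recorded by membership instead of by a binomial exponent.\<close>

lemma generate_int_pow_mult:
  assumes S: "S \<subseteq> carrier G" and u: "u \<in> generate G S" and v: "v \<in> generate G S"
  shows "\<exists>d \<in> commutators G S. (u \<otimes> v) [^] (n::int) = u [^] n \<otimes> v [^] n \<otimes> d"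
proof -
  have uv [simp]: "u \<in> carrier G" "v \<in> carrier G" using S u v generate_in_carrier by auto
  have pow: "w [^] (n::int) \<in> generate G S" if "w \<in> generate G S" for w n
    using subgroup_int_pow_closed[OF generate_is_subgroup[OF S]] that by blast
  have "\<exists>d \<in> commutators G S. (u \<otimes> v) [^] (int n) = u [^] int n \<otimes> v [^] int n \<otimes> d" for n
  proof (induction n)
    case 0
    show ?case by (auto simp: commutators_one intro: bexI[of _ \<one>])
  next
    case (Suc n)
    then obtain d where d: "d \<in> commutators G S"
      "(u \<otimes> v) [^] (int n) = u [^] int n \<otimes> v [^] int n \<otimes> d" by auto
    obtain e where e: "e \<in> commutators G S" "v [^] int n \<otimes> u = u \<otimes> v [^] int n \<otimes> e"
      using generate_swap[OF S pow[OF v] u] by blast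
    have [simp]: "d \<in> carrier G" "e \<in> carrier G" using d e commutators_closed S by auto
    have Suc_pow: "w [^] int (Suc n) = w [^] int n \<otimes> w" if "w \<in> carrier G" for w
      using that int_pow_mult[of w "int n" 1] by (simp add: add.commute)
    have "(u \<otimes> v) [^] int (Suc n) = u [^] int n \<otimes> v [^] int n \<otimes> (d \<otimes> (u \<otimes> v))"
      by (simp add: Suc_pow d m_assoc del: of_nat_Suc)
    also have "\<dots> = u [^] int n \<otimes> (v [^] int n \<otimes> u) \<otimes> v \<otimes> d"
      by (subst commutators_central[OF S d(1)]) (auto simp: m_assoc)
    also have "\<dots> = u [^] int n \<otimes> u \<otimes> v [^] int n \<otimes> (e \<otimes> v) \<otimes> d"
      by (simp add: e(2) m_assoc)
    also have "\<dots> = u [^] int (Suc n) \<otimes> v [^] int (Suc n) \<otimes> (e \<otimes> d)"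
      by (subst commutators_central[OF S e(1)]) (auto simp: m_assoc Suc_pow simp del: of_nat_Suc)
    finally show ?case using commutators_mult[OF e(1) d(1)] by blast
  qed note nat = this
  show ?thesis
  proof (cases "n \<ge> 0")
    case True
    then show ?thesis using nat[of "nat n"] by simp
  next
    case False
    then obtain m where m: "n = - int m" using nonpos_int_cases[of n] by fastforce
    obtain d where d: "d \<in> commutators G S"
      "(u \<otimes> v) [^] int m = u [^] int m \<otimes> v [^] int m \<otimes> d" using nat by blast
    have [simp]: "d \<in> carrier G" using d commutators_closed S by auto
    \<comment> \<open>Inverting the formula for the exponent \<open>m\<close> reverses the two
      powers; one more swap restores their order.\<close>
    have "(u \<otimes> v) [^] n = inv d \<otimes> (v [^] n \<otimes> u [^] n)"
      by (simp add: m int_pow_neg d inv_mult_group)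
    also have "\<dots> = v [^] n \<otimes> u [^] n \<otimes> inv d"
      by (rule commutators_central[OF S]) (use d commutators_inv[OF S] in auto)
    finally have 1: "(u \<otimes> v) [^] n = v [^] n \<otimes> u [^] n \<otimes> inv d" .
    obtain e where e: "e \<in> commutators G S" "v [^] n \<otimes> u [^] n = u [^] n \<otimes> v [^] n \<otimes> e"
      using generate_swap[OF S pow[OF v] pow[OF u]] by blast
    have [simp]: "e \<in> carrier G" using e commutators_closed S by auto
    have "(u \<otimes> v) [^] n = u [^] n \<otimes> v [^] n \<otimes> (e \<otimes> inv d)"
      by (simp add: 1 e(2) m_assoc)
    then show ?thesis using commutators_mult[OF e(1) commutators_inv[OF S d(1)]] by blast
  qed
qed

text \<open>Splits one variable off a word: modulo commutators all powers of \<open>s\<close> can be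
  collected on the left. For a product, the one new correction \<open>f\<close> comes from moving
  \<open>s [^] b\<close> past \<open>v\<close>.\<close>

lemma generate_insert_decomp:
  assumes S: "insert s S \<subseteq> carrier G" and u: "u \<in> generate G (insert s S)"
  shows "\<exists>a::int. \<exists>v \<in> generate G S. \<exists>d \<in> commutators G (insert s S). u = s [^] a \<otimes> v \<otimes> d"
  using u
proof induction
  case one
  show ?case
    by (rule exI[of _ 0], rule bexI[of _ \<one>], rule bexI[of _ \<one>])
      (auto simp: commutators_one generate.one)
next
  case (incl h)
  show ?case
  proof (cases "h = s")
    case True
    with S show ?thesis
      by (intro exI[of _ 1] bexI[of _ \<one>]) (auto simp: commutators_one generate.one)
  next
    case False
    with S incl show ?thesis
      by (intro exI[of _ 0] bexI[of _ h] bexI[of _ \<one>])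
        (auto simp: commutators_one intro: generate.incl)
  qed
next
  case (inv h)
  show ?case
  proof (cases "h = s")
    case True
    with S show ?thesis
      by (intro exI[of _ "-1"] bexI[of _ \<one>]) (auto simp: commutators_one generate.one int_pow_neg)
  next
    case False
    with S inv show ?thesis
      by (intro exI[of _ 0] bexI[of _ "inv h"] bexI[of _ \<one>])
        (auto simp: commutators_one intro: generate.inv)
  qed
next
  case (eng h1 h2)
  then obtain a v d b w e where *:
    "v \<in> generate G S" "d \<in> commutators G (insert s S)" "h1 = s [^] (a::int) \<otimes> v \<otimes> d"
    "w \<in> generate G S" "e \<in> commutators G (insert s S)" "h2 = s [^] (b::int) \<otimes> w \<otimes> e"
    by metis
  have gen: "generate G S \<subseteq> generate G (insert s S)" by (rule mono_generate) auto
  have "s [^] b \<in> generate G (insert s S)"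
    using subgroup_int_pow_closed[OF generate_is_subgroup[OF S]] by (simp add: generate.incl)
  with generate_swap[OF S] * gen obtain f where f: "f \<in> commutators G (insert s S)"
    "v \<otimes> s [^] b = s [^] b \<otimes> v \<otimes> f" by blast
  have [simp]: "d \<in> carrier G" "e \<in> carrier G" "f \<in> carrier G" "s \<in> carrier G"
    "v \<in> carrier G" "w \<in> carrier G"
    using * f S commutators_closed[OF S] generate_in_carrier[of S] by auto
  have "h1 \<otimes> h2 = s [^] a \<otimes> v \<otimes> (d \<otimes> (s [^] b \<otimes> w \<otimes> e))"
    by (simp add: * m_assoc)
  also have "\<dots> = s [^] a \<otimes> (v \<otimes> s [^] b) \<otimes> w \<otimes> e \<otimes> d"
    by (subst commutators_central[OF S *(2)]) (auto simp: m_assoc)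
  also have "\<dots> = s [^] a \<otimes> s [^] b \<otimes> v \<otimes> (f \<otimes> (w \<otimes> e \<otimes> d))"
    by (simp add: f m_assoc)
  also have "\<dots> = s [^] (a + b) \<otimes> (v \<otimes> w) \<otimes> (e \<otimes> d \<otimes> f)"
    by (subst commutators_central[OF S f(1)]) (auto simp: m_assoc int_pow_mult)
  finally have "h1 \<otimes> h2 = s [^] (a + b) \<otimes> (v \<otimes> w) \<otimes> (e \<otimes> d \<otimes> f)" .
  moreover have "v \<otimes> w \<in> generate G S" using * by (blast intro: generate.eng)
  moreover have "e \<otimes> d \<otimes> f \<in> commutators G (insert s S)"
    using *(2,5) f(1) by (blast intro: commutators_mult)
  ultimately show ?case by blast
qed

text \<open>By bilinearity all commutators that involve \<open>s\<close> merge into one commutator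
  of \<open>s\<close> with a single word \<open>u\<close> in the other generators. Simplifying
  \<open>u\<close> then simplifies all of them at once.\<close>

lemma commutators_insert_decomp:
  assumes S: "insert s S \<subseteq> carrier G" and c: "c \<in> commutators G (insert s S)"
  shows "\<exists>u \<in> generate G S. \<exists>d \<in> commutators G S. c = commutator G s u \<otimes> d"
proof -
  have S' [simp]: "S \<subseteq> carrier G" "s \<in> carrier G" using S by auto
  have gen: "\<exists>u \<in> generate G S. \<exists>d \<in> commutators G S. commutator G x y = commutator G s u \<otimes> d"
    if xy: "x \<in> insert s S" "y \<in> insert s S" for x y
  proof -
    have [simp]: "x \<in> carrier G" "y \<in> carrier G" using xy by (auto dest: subsetD[OF S'(1)])
    consider "x = s" "y = s" | "x = s" "y \<in> S" | "x \<in> S" "y = s" | "x \<in> S" "y \<in> S"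
      using xy by blast
    then show ?thesis
    proof cases
      case 1
      then show ?thesis
        by (intro bexI[of _ \<one>] bexI[of _ \<one>])
          (auto simp: commutators_one generate.one commutator_eq_one)
    next
      case 2
      then show ?thesis
        by (intro bexI[of _ y] bexI[of _ \<one>]) (auto simp: commutators_one generate.incl)
    next
      case 3
      \<comment> \<open>To bring \<open>s\<close> to the front, the commutator is inverted, and the
        inverse is absorbed by taking \<open>inv x\<close> as the second entry.\<close>
      then have "commutator G x y = inv (commutator G s x)"
        by (simp flip: commutator_swap)
      with 3 show ?thesis
        by (rule_tac bexI[of _ "inv x"], rule_tac bexI[of _ \<one>])
          (auto simp: commutators_one generate.inv commutator_inv_right)
    next
      case 4
      then show ?thesis
        by (intro bexI[of _ \<one>] bexI[of _ "commutator G x y"])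
          (auto simp: generate.one generate.incl commutator_eq_one commutator_in_commutators)
    qed
  qed
  show ?thesis
    using c unfolding commutators_def[of _ "insert s S"]
  proof induction
    case one
    show ?case
      by (intro bexI[of _ \<one>] bexI[of _ \<one>])
          (auto simp: commutators_one generate.one commutator_eq_one)
  next
    case (incl h)
    then show ?case using gen by auto
  next
    case (inv h)
    then obtain u d where *: "u \<in> generate G S" "d \<in> commutators G S" "h = commutator G s u \<otimes> d"
      using gen by blast
    have [simp]: "u \<in> carrier G" "d \<in> carrier G"
      using * commutators_closed[of S] generate_in_carrier[of S] by auto
    have "inv h = inv d \<otimes> commutator G s (inv u)"
      by (simp add: * inv_mult_group commutator_inv_right)
    also have "\<dots> = commutator G s (inv u) \<otimes> inv d"
      by (simp add: commutator_central)
    finally show ?case using * by (meson S'(1) commutators_inv generate_m_inv_closed)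
  next
    case (eng h1 h2)
    then obtain u d v e where *: "u \<in> generate G S" "d \<in> commutators G S"
      "h1 = commutator G s u \<otimes> d" "v \<in> generate G S" "e \<in> commutators G S"
      "h2 = commutator G s v \<otimes> e" by auto
    have [simp]: "u \<in> carrier G" "d \<in> carrier G" "v \<in> carrier G" "e \<in> carrier G"
      using * commutators_closed[of S] generate_in_carrier[of S] by auto
    have "h1 \<otimes> h2 = commutator G s u \<otimes> (d \<otimes> commutator G s v) \<otimes> e"
      by (simp add: * m_assoc)
    also have "\<dots> = commutator G s (u \<otimes> v) \<otimes> (d \<otimes> e)"
      by (simp add: commutators_central[OF S'(1) *(2)] m_assoc commutator_mult_right)
    finally show ?case using * by (meson commutators_mult generate.eng)
  qed
qed

end

section \<open>Normal form under changes of variables\<close>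

text \<open>The \<open>X i\<close> play the role of variables and \<open>\<A>\<close> is a stock of
  substitutions, closed under composition and containing the moves of the Euclidean algorithm. It is
  instantiated by \<open>word_maps k\<close> with \<open>reparametrisations k\<close>, where
  invertibility is encoded by bijections of tuples.\<close>

locale class2_automorphisms = class2_group +
  fixes X :: "nat \<Rightarrow> 'a" and k :: nat and \<A> :: "('a \<Rightarrow> 'a) set"
  assumes X_closed: "i < k \<Longrightarrow> X i \<in> carrier G"
    and hom: "\<phi> \<in> \<A> \<Longrightarrow> \<phi> \<in> hom G G"
    and id_mem: "id \<in> \<A>"
    and comp_mem: "\<lbrakk>\<phi> \<in> \<A>; \<psi> \<in> \<A>\<rbrakk> \<Longrightarrow> \<phi> \<circ> \<psi> \<in> \<A>"
    and ex_swap: "Suc t < k \<Longrightarrow> \<exists>\<phi> \<in> \<A>. \<phi> (X t) = X (Suc t) \<and> \<phi> (X (Suc t)) = X t \<and>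
      (\<forall>i<k. i \<noteq> t \<longrightarrow> i \<noteq> Suc t \<longrightarrow> \<phi> (X i) = X i)"
    and ex_transvection: "Suc t < k \<Longrightarrow> \<exists>\<phi> \<in> \<A>. \<phi> (X (Suc t)) = X (Suc t) \<otimes> X t [^] (q::int) \<and>
      (\<forall>i<k. i \<noteq> Suc t \<longrightarrow> \<phi> (X i) = X i)"
begin

section \<open>Substitutions that fix the first variables\<close>

abbreviation gens :: "nat \<Rightarrow> 'a set" where
  "gens t \<equiv> X ` {t..<k}"

text \<open>The second condition keeps the variables before \<open>t\<close> out of the new values.
  With it the set is closed under composition and preserves the subgroup generated by
  \<open>gens t\<close>, so a later reduction does not disturb what was achieved for earlier
  variables.\<close>

definition fixing :: "nat \<Rightarrow> ('a \<Rightarrow> 'a) set" where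
  "fixing t = {\<phi> \<in> \<A>. (\<forall>i<k. i < t \<longrightarrow> \<phi> (X i) = X i) \<and>
     (\<forall>i<k. t \<le> i \<longrightarrow> \<phi> (X i) \<in> generate G (gens t))}"

lemma gens_closed: "gens t \<subseteq> carrier G"
  using X_closed by auto

lemma gens_Suc: "t < k \<Longrightarrow> gens t = insert (X t) (gens (Suc t))"
proof -
  assume "t < k"
  then have "{t..<k} = insert t {Suc t..<k}" by auto
  then show ?thesis by simp
qed

lemma id_fixing: "id \<in> fixing t"
  by (auto simp: fixing_def id_mem intro: generate.incl)

lemma group_homI: "\<phi> \<in> fixing t \<Longrightarrow> group_hom G G \<phi>"
  by (simp add: group_hom_def group_hom_axioms_def is_group fixing_def hom)

lemma fixing_generate:
  assumes "\<phi> \<in> fixing t" "u \<in> generate G (gens t)"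
  shows "\<phi> u \<in> generate G (gens t)"
proof -
  interpret \<phi>: group_hom G G \<phi> using assms(1) by (rule group_homI)
  have "\<phi> ` generate G (gens t) = generate G (\<phi> ` gens t)"
    using \<phi>.generate_img[OF gens_closed] by simp
  also have "\<dots> \<subseteq> generate G (gens t)"
    using assms(1) gens_closed
    by (intro generate_subgroup_incl generate_is_subgroup) (auto simp: fixing_def)
  finally show ?thesis using assms(2) by auto
qed

lemma fixing_commutators:
  assumes "\<phi> \<in> fixing t" "d \<in> commutators G (gens t)"
  shows "\<phi> d \<in> commutators G (gens t)"
proof -
  interpret \<phi>: group_hom G G \<phi> using assms(1) by (rule group_homI)
  let ?C = "{commutator G x y | x y. x \<in> gens t \<and> y \<in> gens t}"
  have C: "?C \<subseteq> carrier G" using gens_closed by blast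
  have "\<phi> ` commutators G (gens t) = generate G (\<phi> ` ?C)"
    unfolding commutators_def using \<phi>.generate_img[OF C] by simp
  also have "\<dots> \<subseteq> commutators G (gens t)"
  proof (rule generate_subgroup_incl)
    show "subgroup (commutators G (gens t)) G"
      unfolding commutators_def by (rule generate_is_subgroup) (rule C)
    have "\<phi> (commutator G x y) \<in> commutators G (gens t)" if "x \<in> gens t" "y \<in> gens t" for x y
    proof -
      have "x \<in> carrier G" "y \<in> carrier G" using that gens_closed by blast+
      moreover have "x \<in> generate G (gens t)" "y \<in> generate G (gens t)"
        using that by (blast intro: generate.incl)+
      ultimately show ?thesis
        using fixing_generate[OF assms(1)] commutator_in_commutators[OF gens_closed]
        by (simp add: \<phi>.hom_commutator)
    qed
    then show "\<phi> ` ?C \<subseteq> commutators G (gens t)" by blast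
  qed
  finally show ?thesis using assms(2) by auto
qed

lemma fixing_comp:
  assumes "\<phi> \<in> fixing t" "\<psi> \<in> fixing t"
  shows "\<phi> \<circ> \<psi> \<in> fixing t"
  using assms fixing_generate[OF assms(1)] by (auto simp: fixing_def comp_mem)

lemma fixing_mono:
  assumes "\<phi> \<in> fixing (Suc t)"
  shows "\<phi> \<in> fixing t"
proof -
  have sub: "generate G (gens (Suc t)) \<subseteq> generate G (gens t)"
    by (rule mono_generate) auto
  have "\<phi> (X i) \<in> generate G (gens t)" if "i < k" "t \<le> i" for i
  proof (cases "i = t")
    case True
    then show ?thesis using assms that by (auto simp: fixing_def intro: generate.incl)
  next
    case False
    then show ?thesis using assms that sub by (auto simp: fixing_def)
  qed
  then show ?thesis using assms by (auto simp: fixing_def)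
qed

section \<open>Euclidean reduction of the exponents\<close>

text \<open>The Euclidean algorithm on the pair of exponents, with the absolute value of
  \<open>b\<close> as measure. A transvection replaces \<open>a\<close> by \<open>a mod b\<close>
  and a swap exchanges the two exponents; every reordering of factors costs only
  commutators.\<close>

lemma euclid_two_generators:
  assumes t: "Suc t < k"
  shows "\<exists>\<phi> \<in> fixing t. \<exists>m::int. \<exists>d \<in> commutators G (gens t).
    \<phi> (X t [^] (a::int) \<otimes> X (Suc t) [^] (b::int)) = X t [^] m \<otimes> d"
proof (induction "nat \<bar>b\<bar>" arbitrary: a b rule: less_induct)
  case less
  let ?x = "X t" and ?y = "X (Suc t)" and ?D = "commutators G (gens t)"
  have [simp]: "?x \<in> carrier G" "?y \<in> carrier G" using t X_closed by auto
  have xy: "?x \<in> generate G (gens t)" "?y \<in> generate G (gens t)"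
    using t by (auto intro: generate.incl)
  have pow: "w [^] (n::int) \<in> generate G (gens t)" if "w \<in> generate G (gens t)" for w n
    using subgroup_int_pow_closed[OF generate_is_subgroup[OF gens_closed]] that by blast
  note closed = commutators_closed[OF gens_closed] and central = commutators_central[OF gens_closed]
  show ?case
  proof (cases "b = 0")
    case True
    then show ?thesis
      by (intro bexI[OF _ id_fixing] exI[of _ a] bexI[OF _ commutators_one]) simp
  next
    case False
    \<comment> \<open>Chosen so that \<open>a + q * b = a mod b\<close>.\<close>
    define q where "q = - (a div b)"
    obtain \<phi> where \<phi>: "\<phi> \<in> \<A>" "\<phi> ?y = ?y \<otimes> ?x [^] q" "\<And>i. i < k \<Longrightarrow> i \<noteq> Suc t \<Longrightarrow> \<phi> (X i) = X i"
      using ex_transvection[OF t] by blast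
    have \<phi>': "\<phi> \<in> fixing t"
      unfolding fixing_def
    proof (safe intro!: \<phi>)
      fix i assume i: "i < k" "t \<le> i"
      show "\<phi> (X i) \<in> generate G (gens t)"
      proof (cases "i = Suc t")
        case True
        then show ?thesis using xy pow \<phi>(2) by (auto intro: generate.eng)
      next
        case False
        then show ?thesis using i \<phi>(3) by (auto intro: generate.incl)
      qed
    qed simp_all
    obtain \<sigma> where \<sigma>: "\<sigma> \<in> \<A>" "\<sigma> ?x = ?y" "\<sigma> ?y = ?x"
      "\<And>i. i < k \<Longrightarrow> i \<noteq> t \<Longrightarrow> i \<noteq> Suc t \<Longrightarrow> \<sigma> (X i) = X i"
      using ex_swap[OF t] by blast
    have \<sigma>': "\<sigma> \<in> fixing t"
      unfolding fixing_def
    proof (safe intro!: \<sigma>)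
      fix i assume i: "i < k" "t \<le> i"
      consider "i = t" | "i = Suc t" | "i \<noteq> t" "i \<noteq> Suc t" by blast
      then show "\<sigma> (X i) \<in> generate G (gens t)"
        using i xy \<sigma> by cases (auto intro: generate.incl)
    qed simp_all
    interpret \<phi>: group_hom G G \<phi> using \<phi>' by (rule group_homI)
    interpret \<sigma>: group_hom G G \<sigma> using \<sigma>' by (rule group_homI)
    have r: "nat \<bar>a mod b\<bar> < nat \<bar>b\<bar>"
      using False by (simp add: abs_mod_less)
    obtain \<psi> m d where \<psi>: "\<psi> \<in> fixing t" "d \<in> ?D"
      "\<psi> (?x [^] b \<otimes> ?y [^] (a mod b)) = ?x [^] (m::int) \<otimes> d"
      using less[OF r] by blast
    interpret \<psi>: group_hom G G \<psi> using \<psi>(1) by (rule group_homI)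
    obtain e where e: "e \<in> ?D" "(?y \<otimes> ?x [^] q) [^] b = ?y [^] b \<otimes> (?x [^] q) [^] b \<otimes> e"
      using generate_int_pow_mult[OF gens_closed xy(2) pow[OF xy(1)]] by blast
    obtain f where f: "f \<in> ?D" "?y [^] b \<otimes> ?x [^] (q * b) = ?x [^] (q * b) \<otimes> ?y [^] b \<otimes> f"
      using generate_swap[OF gens_closed pow[OF xy(2)] pow[OF xy(1)]] by blast
    obtain g where g: "g \<in> ?D" "?y [^] (a mod b) \<otimes> ?x [^] b = ?x [^] b \<otimes> ?y [^] (a mod b) \<otimes> g"
      using generate_swap[OF gens_closed pow[OF xy(2)] pow[OF xy(1)]] by blast
    have [simp]: "d \<in> carrier G" "e \<in> carrier G" "f \<in> carrier G" "g \<in> carrier G"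
      using \<psi>(2) e(1) f(1) g(1) closed by blast+
    have fixx: "\<phi> ?x = ?x" using \<phi>(3) t by simp
    have "\<phi> (?x [^] a \<otimes> ?y [^] b) = ?x [^] a \<otimes> (?y [^] b \<otimes> ?x [^] (q * b) \<otimes> e)"
      by (simp add: \<phi>.hom_int_pow fixx \<phi>(2) e int_pow_pow)
    also have "\<dots> = ?x [^] a \<otimes> ?x [^] (q * b) \<otimes> ?y [^] b \<otimes> (f \<otimes> e)"
      by (simp add: f m_assoc)
    also have "?x [^] a \<otimes> ?x [^] (q * b) = ?x [^] (a mod b)"
      by (simp add: q_def minus_div_mult_eq_mod flip: int_pow_mult)
    finally have "(\<sigma> \<circ> \<phi>) (?x [^] a \<otimes> ?y [^] b) = ?y [^] (a mod b) \<otimes> ?x [^] b \<otimes> \<sigma> (f \<otimes> e)"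
      by (simp add: \<sigma>.hom_int_pow \<sigma>)
    also have "\<dots> = ?x [^] b \<otimes> ?y [^] (a mod b) \<otimes> (g \<otimes> \<sigma> (f \<otimes> e))"
      by (simp add: g m_assoc)
    finally have "(\<psi> \<circ> (\<sigma> \<circ> \<phi>)) (?x [^] a \<otimes> ?y [^] b)
        = \<psi> (?x [^] b \<otimes> ?y [^] (a mod b)) \<otimes> \<psi> (g \<otimes> \<sigma> (f \<otimes> e))"
      by (simp del: \<phi>.hom_mult \<sigma>.hom_mult)
    then have "(\<psi> \<circ> (\<sigma> \<circ> \<phi>)) (?x [^] a \<otimes> ?y [^] b)
        = ?x [^] m \<otimes> (d \<otimes> \<psi> (g \<otimes> \<sigma> (f \<otimes> e)))"
      unfolding \<psi>(3) by (simp add: m_assoc)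
    moreover have "d \<otimes> \<psi> (g \<otimes> \<sigma> (f \<otimes> e)) \<in> ?D"
      by (intro commutators_mult \<psi>(2) e(1) f(1) g(1) fixing_commutators[OF \<psi>(1)]
          fixing_commutators[OF \<sigma>'])
    moreover have "\<psi> \<circ> (\<sigma> \<circ> \<phi>) \<in> fixing t"
      by (intro fixing_comp \<psi>(1) \<sigma>' \<phi>')
    ultimately show ?thesis by blast
  qed
qed

text \<open>Works from the last variable down. After \<open>X t\<close> is split off, the rest is
  reduced by a substitution that fixes \<open>X t\<close>; what remains, up to commutators, is a
  product of powers of \<open>X t\<close> and \<open>X (Suc t)\<close>, to which
  \<open>euclid_two_generators\<close> applies.\<close>

lemma generate_reduce:
  assumes "t < k" "u \<in> generate G (gens t)"
  shows "\<exists>\<phi> \<in> fixing t. \<exists>m::int. \<exists>d \<in> commutators G (gens t). \<phi> u = X t [^] m \<otimes> d"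
  using assms
proof (induction "k - t" arbitrary: t u rule: less_induct)
  case less
  note t = less.prems(1)
  have [simp]: "X t \<in> carrier G" using t X_closed by auto
  obtain a v d where u: "v \<in> generate G (gens (Suc t))" "d \<in> commutators G (gens t)"
    "u = X t [^] (a::int) \<otimes> v \<otimes> d"
    using generate_insert_decomp[of "X t" "gens (Suc t)" u] less.prems(2) gens_closed[of t]
    unfolding gens_Suc[OF t] by blast
  have [simp]: "v \<in> carrier G" using u(1) generate_in_carrier gens_closed by blast
  have [simp]: "d \<in> carrier G" using u(2) commutators_closed gens_closed by blast
  show ?case
  proof (cases "Suc t < k")
    case False
    then have "gens (Suc t) = {}" by auto
    then have "v = \<one>" using u(1) generate_empty by auto
    then have "id u = X t [^] a \<otimes> d" using u(3) by simp
    then show ?thesis using u(2) id_fixing by blast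
  next
    case True
    then obtain \<phi> b e where \<phi>: "\<phi> \<in> fixing (Suc t)" "e \<in> commutators G (gens (Suc t))"
      "\<phi> v = X (Suc t) [^] (b::int) \<otimes> e"
      using less.hyps[OF diff_less_mono2[OF lessI t] True u(1)] by blast
    then have \<phi>': "\<phi> \<in> fixing t" by (blast intro: fixing_mono)
    obtain \<psi> m f where \<psi>: "\<psi> \<in> fixing t" "f \<in> commutators G (gens t)"
      "\<psi> (X t [^] a \<otimes> X (Suc t) [^] b) = X t [^] (m::int) \<otimes> f"
      using euclid_two_generators[OF True] by blast
    interpret \<phi>: group_hom G G \<phi> using \<phi>' by (rule group_homI)
    interpret \<psi>: group_hom G G \<psi> using \<psi>(1) by (rule group_homI)
    have e: "e \<in> commutators G (gens t)"
      using \<phi>(2) commutators_mono[of "gens (Suc t)" "gens t"] by fastforce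
    have [simp]: "e \<in> carrier G" "f \<in> carrier G" "X (Suc t) \<in> carrier G"
      using commutators_closed[OF gens_closed e] commutators_closed[OF gens_closed \<psi>(2)]
        X_closed[OF True] by simp_all
    have fixx: "\<phi> (X t) = X t" using \<phi>(1) t by (simp add: fixing_def)
    have "\<phi> u = X t [^] a \<otimes> X (Suc t) [^] b \<otimes> (e \<otimes> \<phi> d)"
      by (simp add: u \<phi>(3) \<phi>.hom_int_pow fixx m_assoc)
    then have "(\<psi> \<circ> \<phi>) u
        = \<psi> (X t [^] a \<otimes> X (Suc t) [^] b) \<otimes> \<psi> (e \<otimes> \<phi> d)"
      by simp
    then have "(\<psi> \<circ> \<phi>) u = X t [^] m \<otimes> (f \<otimes> \<psi> (e \<otimes> \<phi> d))"
      unfolding \<psi>(3) by (simp add: m_assoc)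
    moreover have "f \<otimes> \<psi> (e \<otimes> \<phi> d) \<in> commutators G (gens t)"
      by (intro commutators_mult \<psi>(2) e u(2) fixing_commutators[OF \<psi>(1)] fixing_commutators[OF \<phi>'])
    ultimately show ?thesis using fixing_comp[OF \<psi>(1) \<phi>'] by blast
  qed
qed

section \<open>Reduction of the commutator part\<close>

text \<open>The reduction yields only commutators of consecutive variables. Of this only the parity
  is kept: each generator pairs an even index with an odd one, which makes the values linear in the
  even coordinates once the odd ones are fixed.\<close>

definition odd_commutators :: "'a set" where
  "odd_commutators = generate G {commutator G (X i) (X j) | i j. i < k \<and> j < k \<and> odd (i + j)}"

lemma odd_commutators_subgroup: "subgroup odd_commutators G"
  unfolding odd_commutators_def using X_closed by (intro generate_is_subgroup) blast

text \<open>Splits \<open>c\<close> into a commutator of \<open>X t\<close> with one word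
  \<open>u\<close> and a part \<open>d\<close> in the later variables. A substitution fixing
  \<open>X t\<close> turns \<open>u\<close> into a power of \<open>X (Suc t)\<close> up to a central
  factor, so the first part becomes a power of the commutator of two consecutive variables; the
  image of \<open>d\<close> is handled recursively.\<close>

lemma commutators_reduce:
  assumes "c \<in> commutators G (gens t)"
  shows "\<exists>\<phi> \<in> fixing (Suc t). \<phi> c \<in> odd_commutators"
  using assms
proof (induction "k - t" arbitrary: t c rule: less_induct)
  case less
  have one: "\<one> \<in> odd_commutators"
    using odd_commutators_subgroup by (rule subgroup.one_closed)
  have empty: "d = \<one>" if "d \<in> commutators G (gens s)" "s \<ge> k" for d s
    using that generate_empty by (simp add: commutators_def)
  show ?case
  proof (cases "t < k")
    case False
    then show ?thesis
      using empty[OF less.prems] one id_fixing by (intro bexI[of _ id]) auto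
  next
    case True
    obtain u d where c: "u \<in> generate G (gens (Suc t))" "d \<in> commutators G (gens (Suc t))"
      "c = commutator G (X t) u \<otimes> d"
      using commutators_insert_decomp[of "X t" "gens (Suc t)" c] less.prems gens_closed[of t]
      unfolding gens_Suc[OF True] by blast
    have [simp]: "X t \<in> carrier G" "u \<in> carrier G" "d \<in> carrier G"
      using X_closed[OF True] commutators_closed[OF gens_closed c(2)]
        generate_in_carrier[OF gens_closed c(1)] by simp_all
    show ?thesis
    proof (cases "Suc t < k")
      case False
      then have "gens (Suc t) = {}" by auto
      then have "u = \<one>" using c(1) generate_empty by auto
      moreover have "d = \<one>" using empty[OF c(2)] False by simp
      ultimately have "c = \<one>" using c(3) by (simp add: commutator_eq_one)
      then show ?thesis using one id_fixing by (intro bexI[of _ id]) auto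
    next
      case t: True
      obtain \<phi> m e where \<phi>: "\<phi> \<in> fixing (Suc t)" "e \<in> commutators G (gens (Suc t))"
        "\<phi> u = X (Suc t) [^] (m::int) \<otimes> e"
        using generate_reduce[OF t c(1)] by blast
      have "\<phi> d \<in> commutators G (gens (Suc t))"
        using \<phi>(1) c(2) by (rule fixing_commutators)
      \<comment> \<open>The induction hypothesis is used at \<open>Suc t\<close>, so
        \<open>\<psi>\<close> fixes both \<open>X t\<close> and \<open>X (Suc t)\<close> and
        preserves the commutator already obtained.\<close>
      then obtain \<psi> where \<psi>: "\<psi> \<in> fixing (Suc (Suc t))" "\<psi> (\<phi> d) \<in> odd_commutators"
        using less.hyps[OF diff_less_mono2[OF lessI True]] by blast
      have \<psi>': "\<psi> \<in> fixing (Suc t)" using \<psi>(1) by (rule fixing_mono)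
      interpret \<phi>: group_hom G G \<phi> using \<phi>(1) by (rule group_homI)
      interpret \<psi>: group_hom G G \<psi> using \<psi>(1) by (rule group_homI)
      have y [simp]: "X (Suc t) \<in> carrier G" "e \<in> carrier G"
        using t X_closed \<phi>(2) commutators_closed[OF gens_closed] by auto
      have "commutator G (X t) e = \<one>"
        using commutators_central[OF gens_closed \<phi>(2), of "X t"] by (intro commutator_eq_one) auto
      then have \<phi>c: "\<phi> c = commutator G (X t) (X (Suc t)) [^] m \<otimes> \<phi> d"
        using \<phi>(1) True
        by (simp add: c(3) \<phi>.hom_commutator \<phi>(3) fixing_def commutator_mult_right
            commutator_int_pow_right)
      have "\<psi> (X t) = X t" "\<psi> (X (Suc t)) = X (Suc t)"
        using \<psi>(1) t by (simp_all add: fixing_def)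
      then have "(\<psi> \<circ> \<phi>) c = commutator G (X t) (X (Suc t)) [^] m \<otimes> \<psi> (\<phi> d)"
        by (simp add: \<phi>c \<psi>.hom_int_pow \<psi>.hom_commutator)
      moreover have "commutator G (X t) (X (Suc t)) \<in> odd_commutators"
        unfolding odd_commutators_def using t by (intro generate.incl) fastforce
      ultimately have "(\<psi> \<circ> \<phi>) c \<in> odd_commutators"
        using \<psi>(2) subgroup.m_closed[OF odd_commutators_subgroup]
          subgroup_int_pow_closed[OF odd_commutators_subgroup] by simp
      then show ?thesis using fixing_comp[OF \<psi>' \<phi>(1)] by blast
    qed
  qed
qed

lemma normal_form:
  assumes "0 < k" "u \<in> generate G (X ` {..<k})"
  shows "\<exists>\<phi> \<in> \<A>. \<exists>m::int. \<exists>c \<in> odd_commutators. \<phi> u = X 0 [^] m \<otimes> c"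
proof -
  have "u \<in> generate G (gens 0)" using assms(2) by (simp add: lessThan_atLeast0)
  then obtain \<phi> m d where \<phi>: "\<phi> \<in> fixing 0" "d \<in> commutators G (gens 0)" "\<phi> u = X 0 [^] (m::int) \<otimes> d"
    using generate_reduce assms(1) by blast
  \<comment> \<open>Membership in \<open>fixing (Suc 0)\<close> means that this second substitution
    leaves the power of \<open>X 0\<close> intact.\<close>
  obtain \<psi> where \<psi>: "\<psi> \<in> fixing (Suc 0)" "\<psi> d \<in> odd_commutators"
    using commutators_reduce[OF \<phi>(2)] by blast
  interpret \<psi>: group_hom G G \<psi> using \<psi>(1) by (rule group_homI)
  have "X 0 \<in> carrier G" "d \<in> carrier G"
    using assms(1) X_closed \<phi>(2) commutators_closed[OF gens_closed] by auto
  then have "(\<psi> \<circ> \<phi>) u = X 0 [^] m \<otimes> \<psi> d"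
    using \<psi>(1) assms(1) by (simp add: \<phi>(3) \<psi>.hom_int_pow fixing_def)
  moreover have "\<psi> \<circ> \<phi> \<in> \<A>"
    using \<psi>(1) \<phi>(1) comp_mem by (simp add: fixing_def)
  ultimately show ?thesis using \<psi>(2) by blast
qed

end

section \<open>Word maps on tuples\<close>

context class2_group
begin

abbreviation tuples :: "nat \<Rightarrow> (nat \<Rightarrow> 'a) set" where
  "tuples k \<equiv> {..<k} \<rightarrow>\<^sub>E carrier G"

text \<open>This function group stands in for a relatively free group: words are identified when
  they have the same values on \<open>G\<close>, and a substitution acts by precomposition.\<close>

abbreviation word_maps :: "nat \<Rightarrow> ((nat \<Rightarrow> 'a) \<Rightarrow> 'a) monoid" where
  "word_maps k \<equiv> product_group (tuples k) (\<lambda>_. G)"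

definition proj :: "nat \<Rightarrow> nat \<Rightarrow> (nat \<Rightarrow> 'a) \<Rightarrow> 'a" where
  "proj k i = (\<lambda>g \<in> tuples k. g i)"

text \<open>The bijection \<open>\<tau>\<close> is what preserves the number of solutions. The
  formula is imposed only on the carrier and on tuples, which admits \<open>id\<close> next to
  functions defined by restriction.\<close>

definition reparametrisations :: "nat \<Rightarrow> (((nat \<Rightarrow> 'a) \<Rightarrow> 'a) \<Rightarrow> ((nat \<Rightarrow> 'a) \<Rightarrow> 'a)) set" where
  "reparametrisations k = {\<phi> \<in> hom (word_maps k) (word_maps k).
     \<exists>\<tau>. bij_betw \<tau> (tuples k) (tuples k) \<and>
       (\<forall>u \<in> carrier (word_maps k). \<forall>g \<in> tuples k. \<phi> u g = u (\<tau> g))}"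

lemma word_maps_group: "group (word_maps k)"
  by (simp add: is_group)

lemma eval_hom:
  assumes g: "g \<in> tuples k"
  shows "group_hom (word_maps k) G (\<lambda>u. u g)"
proof -
  have "(\<lambda>u. u g) \<in> hom (word_maps k) G"
    by (rule homI) (use PiE_mem[OF _ g] g in simp_all)
  then show ?thesis
    by (simp add: group_hom_def group_hom_axioms_def is_group)
qed

lemma word_map_eqI:
  "\<lbrakk>u \<in> carrier (word_maps k); v \<in> carrier (word_maps k); \<And>g. g \<in> tuples k \<Longrightarrow> u g = v g\<rbrakk> \<Longrightarrow> u = v"
  unfolding carrier_product_group by (rule PiE_ext)

lemma word_maps_class2: "class2_group (word_maps k)"
proof -
  interpret W: group "word_maps k" by (rule word_maps_group)
  show ?thesis
  proof
    fix x y z assume *: "x \<in> carrier (word_maps k)" "y \<in> carrier (word_maps k)" "z \<in> carrier (word_maps k)"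
    show "commutator (word_maps k) x y \<otimes>\<^bsub>word_maps k\<^esub> z = z \<otimes>\<^bsub>word_maps k\<^esub> commutator (word_maps k) x y"
    proof (rule word_map_eqI)
      fix g assume g: "g \<in> tuples k"
      interpret ev: group_hom "word_maps k" G "\<lambda>u. u g" using g by (rule eval_hom)
      have "x g \<in> carrier G" "y g \<in> carrier G" "z g \<in> carrier G"
        using * ev.hom_closed by blast+
      then show "(commutator (word_maps k) x y \<otimes>\<^bsub>word_maps k\<^esub> z) g =
          (z \<otimes>\<^bsub>word_maps k\<^esub> commutator (word_maps k) x y) g"
        using ev.hom_mult[OF W.commutator_closed[OF *(1,2)] *(3)]
          ev.hom_mult[OF *(3) W.commutator_closed[OF *(1,2)]] ev.hom_commutator[OF *(1,2)]
          commutator_central by metis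
    qed (use * W.m_closed W.commutator_closed in blast)+
  qed
qed

lemma proj_closed: "i < k \<Longrightarrow> proj k i \<in> carrier (word_maps k)"
  by (auto simp: proj_def)

lemma proj_apply: "g \<in> tuples k \<Longrightarrow> proj k i g = g i"
  by (simp add: proj_def)

section \<open>Elementary substitutions as precompositions\<close>

lemma precomp_reparametrisation:
  assumes "bij_betw \<tau> (tuples k) (tuples k)"
  shows "(\<lambda>u. \<lambda>g \<in> tuples k. u (\<tau> g)) \<in> reparametrisations k"
proof -
  have \<tau>: "\<tau> g \<in> tuples k" if "g \<in> tuples k" for g
    using bij_betwE[OF assms] that by simp
  have "u (\<tau> g) \<in> carrier G" if "u \<in> tuples k \<rightarrow>\<^sub>E carrier G" "g \<in> tuples k" for u g
    using PiE_mem[OF that(1) \<tau>[OF that(2)]] .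
  note \<tau> this
  then show ?thesis
    using assms unfolding reparametrisations_def
    by (intro CollectI conjI homI exI[of _ \<tau>])
      (auto simp del: PiE_iff intro!: restrict_ext)
qed

lemma precomp_proj:
  assumes "\<And>g. g \<in> tuples k \<Longrightarrow> \<tau> g \<in> tuples k" "\<And>g. g \<in> tuples k \<Longrightarrow> \<tau> g i = g j"
  shows "(\<lambda>g \<in> tuples k. proj k i (\<tau> g)) = proj k j"
  unfolding proj_def[of k j] by (rule restrict_ext) (simp add: proj_apply assms)

lemma swap_reparametrisation:
  assumes t: "Suc t < k"
  shows "\<exists>\<phi> \<in> reparametrisations k. \<phi> (proj k t) = proj k (Suc t) \<and> \<phi> (proj k (Suc t)) = proj k t \<and>
      (\<forall>i<k. i \<noteq> t \<longrightarrow> i \<noteq> Suc t \<longrightarrow> \<phi> (proj k i) = proj k i)"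
proof -
  define \<tau> where "\<tau> g = g(t := g (Suc t), Suc t := g t)" for g :: "nat \<Rightarrow> 'a"
  have \<tau>: "\<tau> g \<in> tuples k" if "g \<in> tuples k" for g
    using that t by (auto simp: \<tau>_def PiE_iff extensional_def)
  have "bij_betw \<tau> (tuples k) (tuples k)"
    by (rule bij_betw_byWitness[where f' = \<tau>]) (use \<tau> in \<open>auto simp: \<tau>_def fun_eq_iff\<close>)
  then have "(\<lambda>u. \<lambda>g \<in> tuples k. u (\<tau> g)) \<in> reparametrisations k"
    by (rule precomp_reparametrisation)
  moreover have "(\<lambda>g \<in> tuples k. proj k t (\<tau> g)) = proj k (Suc t)"
    "(\<lambda>g \<in> tuples k. proj k (Suc t) (\<tau> g)) = proj k t"
    by (rule precomp_proj, erule \<tau>, simp add: \<tau>_def)+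
  moreover have "(\<lambda>g \<in> tuples k. proj k i (\<tau> g)) = proj k i" if "i \<noteq> t" "i \<noteq> Suc t" for i
    by (rule precomp_proj, erule \<tau>) (use that in \<open>simp add: \<tau>_def\<close>)
  ultimately show ?thesis
    by (intro bexI[where x = "\<lambda>u. \<lambda>g \<in> tuples k. u (\<tau> g)"]) simp_all
qed

lemma transvection_reparametrisation:
  assumes t: "Suc t < k"
  shows "\<exists>\<phi> \<in> reparametrisations k.
      \<phi> (proj k (Suc t)) = proj k (Suc t) \<otimes>\<^bsub>word_maps k\<^esub> proj k t [^]\<^bsub>word_maps k\<^esub> (q::int) \<and>
      (\<forall>i<k. i \<noteq> Suc t \<longrightarrow> \<phi> (proj k i) = proj k i)"
proof -
  define \<tau> where "\<tau> q g = g(Suc t := g (Suc t) \<otimes> g t [^] q)" for q :: int and g :: "nat \<Rightarrow> 'a"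
  have \<tau>: "\<tau> q g \<in> tuples k" if "g \<in> tuples k" for q g
    using that t by (auto simp: \<tau>_def PiE_iff extensional_def)
  \<comment> \<open>\<open>\<tau> q\<close> does not change \<open>g t\<close>, so multiplying by
    the opposite power of the same element undoes it.\<close>
  have inv: "\<tau> (- q) (\<tau> q g) = g" if "g \<in> tuples k" for q g
  proof -
    have "g t \<in> carrier G" "g (Suc t) \<in> carrier G" using PiE_mem[OF that] t by simp_all
    then have "g (Suc t) \<otimes> g t [^] q \<otimes> g t [^] (- q) = g (Suc t)"
      by (simp add: m_assoc int_pow_neg)
    then show ?thesis by (simp add: \<tau>_def)
  qed
  have "bij_betw (\<tau> q) (tuples k) (tuples k)"
    by (rule bij_betw_byWitness[where f' = "\<tau> (- q)"]) (use \<tau> inv inv[of _ "- q"] in auto)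
  then have "(\<lambda>u. \<lambda>g \<in> tuples k. u (\<tau> q g)) \<in> reparametrisations k"
    by (rule precomp_reparametrisation)
  moreover have "(\<lambda>g \<in> tuples k. proj k (Suc t) (\<tau> q g)) =
      proj k (Suc t) \<otimes>\<^bsub>word_maps k\<^esub> proj k t [^]\<^bsub>word_maps k\<^esub> q" (is "_ = ?r")
  proof
    fix g
    show "(\<lambda>g \<in> tuples k. proj k (Suc t) (\<tau> q g)) g = ?r g"
    proof (cases "g \<in> tuples k")
      case True
      interpret ev: group_hom "word_maps k" G "\<lambda>u. u g" using True by (rule eval_hom)
      have "(proj k t [^]\<^bsub>word_maps k\<^esub> q) g = g t [^] q"
        using ev.hom_int_pow[OF proj_closed, of t q] t True by (simp add: proj_apply)
      then show ?thesis using True \<tau>[OF True] by (simp add: proj_apply) (simp add: \<tau>_def)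
    next
      case False
      then show ?thesis by simp
    qed
  qed
  moreover have "(\<lambda>g \<in> tuples k. proj k i (\<tau> q g)) = proj k i" if "i \<noteq> Suc t" for i
    by (rule precomp_proj, erule \<tau>) (use that in \<open>simp add: \<tau>_def\<close>)
  ultimately show ?thesis
    by (intro bexI[where x = "\<lambda>u. \<lambda>g \<in> tuples k. u (\<tau> q g)"]) simp_all
qed

lemma word_maps_automorphisms: "class2_automorphisms (word_maps k) (proj k) k (reparametrisations k)"
proof -
  interpret W: class2_group "word_maps k" by (rule word_maps_class2)
  show ?thesis
  proof
    show "\<phi> \<in> hom (word_maps k) (word_maps k)" if "\<phi> \<in> reparametrisations k" for \<phi>
      using that by (simp add: reparametrisations_def)
    show "id \<in> reparametrisations k"
      by (auto simp: reparametrisations_def hom_def intro: bij_betw_id)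
    show "\<phi> \<circ> \<psi> \<in> reparametrisations k"
      if \<phi>: "\<phi> \<in> reparametrisations k" and \<psi>: "\<psi> \<in> reparametrisations k" for \<phi> \<psi>
    proof -
      obtain \<sigma> where \<sigma>: "bij_betw \<sigma> (tuples k) (tuples k)"
        "\<And>u g. u \<in> carrier (word_maps k) \<Longrightarrow> g \<in> tuples k \<Longrightarrow> \<phi> u g = u (\<sigma> g)"
        using \<phi> unfolding reparametrisations_def by blast
      obtain \<tau> where \<tau>: "bij_betw \<tau> (tuples k) (tuples k)"
        "\<And>u g. u \<in> carrier (word_maps k) \<Longrightarrow> g \<in> tuples k \<Longrightarrow> \<psi> u g = u (\<tau> g)"
        using \<psi> unfolding reparametrisations_def by blast
      have hom: "\<phi> \<in> hom (word_maps k) (word_maps k)" "\<psi> \<in> hom (word_maps k) (word_maps k)"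
        using \<phi> \<psi> by (simp_all add: reparametrisations_def)
      \<comment> \<open>Precomposition reverses the order of the two bijections.\<close>
      have "(\<phi> \<circ> \<psi>) u g = u ((\<tau> \<circ> \<sigma>) g)"
        if "u \<in> carrier (word_maps k)" "g \<in> tuples k" for u g
        using that \<sigma>(2)[OF hom_in_carrier[OF hom(2)]] \<tau>(2)[of u "\<sigma> g"] bij_betwE[OF \<sigma>(1)]
        by simp
      moreover have "bij_betw (\<tau> \<circ> \<sigma>) (tuples k) (tuples k)"
        using \<sigma>(1) \<tau>(1) by (rule bij_betw_trans)
      ultimately show ?thesis
        unfolding reparametrisations_def using Group.hom_compose[OF hom(2,1)] by blast
    qed
  qed (fact proj_closed swap_reparametrisation transvection_reparametrisation)+
qed

lemma card_zeros_reparametrisation: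
  assumes "\<phi> \<in> reparametrisations k" "u \<in> carrier (word_maps k)"
  shows "card {g \<in> tuples k. \<phi> u g = a} = card {g \<in> tuples k. u g = a}"
proof -
  obtain \<tau> where \<tau>: "bij_betw \<tau> (tuples k) (tuples k)" "\<And>g. g \<in> tuples k \<Longrightarrow> \<phi> u g = u (\<tau> g)"
    using assms unfolding reparametrisations_def by blast
  have "bij_betw \<tau> {g \<in> tuples k. \<phi> u g = a} {g \<in> tuples k. u g = a}"
    unfolding bij_betw_def
  proof
    show "inj_on \<tau> {g \<in> tuples k. \<phi> u g = a}"
      using \<tau>(1) by (auto simp: bij_betw_def intro: inj_on_subset)
    show "\<tau> ` {g \<in> tuples k. \<phi> u g = a} = {g \<in> tuples k. u g = a}"
    proof (intro equalityI subsetI)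
      fix h assume h: "h \<in> {g \<in> tuples k. u g = a}"
      then have "h \<in> \<tau> ` tuples k"
        using bij_betw_imp_surj_on[OF \<tau>(1)] by simp
      then obtain g where "g \<in> tuples k" "h = \<tau> g" by blast
      then show "h \<in> \<tau> ` {g \<in> tuples k. \<phi> u g = a}" using \<tau>(2) h by auto
    next
      fix h assume "h \<in> \<tau> ` {g \<in> tuples k. \<phi> u g = a}"
      then show "h \<in> {g \<in> tuples k. u g = a}" using \<tau>(2) bij_betwE[OF \<tau>(1)] by auto
    qed
  qed
  then show ?thesis by (rule bij_betw_same_card)
qed

section \<open>Counting solutions\<close>

text \<open>\<open>c\<close> is central in the group of word maps, which contains the constant
  functions. Commuting with the constant \<open>z\<close> gives the claim at each tuple.\<close>

lemma word_map_central:
  assumes c: "c \<in> commutators (word_maps k) (proj k ` {..<k})" and g: "g \<in> tuples k" and z: "z \<in> carrier G"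
  shows "c g \<otimes> z = z \<otimes> c g"
proof -
  interpret W: class2_group "word_maps k" by (rule word_maps_class2)
  interpret ev: group_hom "word_maps k" G "\<lambda>u. u g" using g by (rule eval_hom)
  define v where "v = (\<lambda>g \<in> tuples k. z)"
  have S: "proj k ` {..<k} \<subseteq> carrier (word_maps k)" using proj_closed by blast
  have *: "c \<in> carrier (word_maps k)" "v \<in> carrier (word_maps k)"
    using W.commutators_closed[OF S c] z by (simp_all add: v_def)
  have "c g \<otimes> v g = v g \<otimes> c g"
    using ev.hom_mult[OF *] ev.hom_mult[OF *(2,1)] W.commutators_central[OF S c *(2)] by metis
  then show ?thesis using g by (simp add: v_def)
qed

text \<open>With the odd coordinates frozen, \<open>c\<close> is a homomorphism in the even coordinates that ignores
  central factors.\<close>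

lemma odd_commutators_shift:
  assumes c: "c \<in> class2_automorphisms.odd_commutators (word_maps k) (proj k) k"
    and g: "g \<in> tuples k" and s: "s \<in> tuples k" and gs: "\<And>i. i < k \<Longrightarrow> odd i \<Longrightarrow> g i = s i"
    and z: "\<And>i. z i \<in> carrier G" "\<And>i y. y \<in> carrier G \<Longrightarrow> z i \<otimes> y = y \<otimes> z i"
  shows "c (\<lambda>i \<in> {..<k}. if odd i then g i else z i \<otimes> g i \<otimes> s i [^] (n::int)) = c g \<otimes> c s [^] n"
proof -
  let ?W = "word_maps k" and ?h = "\<lambda>i \<in> {..<k}. if odd i then g i else z i \<otimes> g i \<otimes> s i [^] n"
  interpret W: class2_automorphisms ?W "proj k" k "reparametrisations k"
    by (rule word_maps_automorphisms)
  have mem: "g i \<in> carrier G" "s i \<in> carrier G" if "i < k" for i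
    using PiE_mem[OF g] PiE_mem[OF s] that by simp_all
  have h: "?h \<in> tuples k"
    using mem z(1) by (intro restrict_PiE_iff[THEN iffD2]) simp
  interpret evg: group_hom ?W G "\<lambda>u. u g" using g by (rule eval_hom)
  interpret evs: group_hom ?W G "\<lambda>u. u s" using s by (rule eval_hom)
  interpret evh: group_hom ?W G "\<lambda>u. u ?h" using h by (rule eval_hom)
  let ?X = "proj k ` {..<k}" and ?C = "{commutator ?W (proj k i) (proj k j) |i j. i < k \<and> j < k \<and> odd (i + j)}"
  have X: "?X \<subseteq> carrier ?W" using proj_closed by blast
  have CX: "?C \<subseteq> {commutator ?W x y |x y. x \<in> ?X \<and> y \<in> ?X}" by blast
  have sub: "generate ?W ?C \<subseteq> commutators ?W ?X"
    unfolding commutators_def using CX by (rule W.mono_generate)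
  have closed: "d \<in> carrier ?W" if "d \<in> generate ?W ?C" for d
    using W.commutators_closed[OF X] sub that by blast
  have ev: "commutator ?W (proj k i) (proj k j) f = commutator G (f i) (f j)"
    if "i < k" "j < k" "f \<in> tuples k" for i j f
    using group_hom.hom_commutator[OF eval_hom[OF that(3)] proj_closed[OF that(1)] proj_closed[OF that(2)]]
      that(3) by (simp add: proj_apply)
  \<comment> \<open>With \<open>i\<close> odd the first entry \<open>g i = s i\<close> is frozen.
    The second entry expands by linearity, and its central factor \<open>z j\<close> contributes
    nothing.\<close>
  have base: "commutator G (?h i) (?h j) = commutator G (g i) (g j) \<otimes> commutator G (s i) (s j) [^] n"
    if i: "i < k" "odd i" and j: "j < k" "even j" for i j
  proof -
    have "commutator G (g i) (z j) = \<one>"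
      using mem[OF i(1)] z by (intro commutator_eq_one) auto
    then show ?thesis
      using mem[OF i(1)] mem[OF j(1)] z(1) i j gs[OF i]
      by (simp add: commutator_mult_right commutator_int_pow_right)
  qed
  have gen: "d ?h = d g \<otimes> d s [^] n" if d: "d \<in> ?C" for d
  proof -
    obtain i j where ij: "i < k" "j < k" "odd (i + j)" "d = commutator ?W (proj k i) (proj k j)"
      using d by blast
    have hm: "?h i \<in> carrier G" "?h j \<in> carrier G" using PiE_mem[OF h] ij by blast+
    show ?thesis
    proof (cases "odd i")
      case True
      then show ?thesis using base[of i j] ij by (simp only: ev h g s) simp
    next
      case False
      then have "odd j" using ij by simp
      have "d ?h = inv (commutator G (?h j) (?h i))"
        using commutator_swap[OF hm] ij h by (simp only: ev)
      also have "\<dots> = inv (commutator G (g j) (g i) \<otimes> commutator G (s j) (s i) [^] n)"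
        using base[of j i] ij False \<open>odd j\<close> by simp
      also have "\<dots> = inv (commutator G (s j) (s i) [^] n) \<otimes> commutator G (g i) (g j)"
        using mem ij commutator_swap[of "g i" "g j"] by (simp add: inv_mult_group)
      also have "\<dots> = commutator G (s i) (s j) [^] n \<otimes> commutator G (g i) (g j)"
        using mem ij commutator_swap[of "s i" "s j"] by (simp add: int_pow_inv)
      also have "\<dots> = commutator G (g i) (g j) \<otimes> commutator G (s i) (s j) [^] n"
        by (rule commutator_central[symmetric]) (use mem ij in auto)
      finally show ?thesis using ij g s by (simp only: ev)
    qed
  qed
  \<comment> \<open>The formula passes from generators to inverses and products because all values
    involved are central.\<close>
  show ?thesis
    using c unfolding W.odd_commutators_def
  proof induction
    case one
    show ?case
      by (simp only: evh.hom_one evg.hom_one evs.hom_one int_pow_one r_one one_closed)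
  next
    case (incl d)
    then show ?case by (rule gen)
  next
    case (inv d)
    then have "d \<in> generate ?W ?C" by (rule generate.incl)
    then have d: "d \<in> carrier ?W" and "d \<in> commutators ?W ?X" using closed sub by auto
    note central = word_map_central[OF \<open>d \<in> commutators ?W ?X\<close>]
    have "(inv\<^bsub>?W\<^esub> d) ?h = inv (d g \<otimes> d s [^] n)"
      by (simp only: evh.hom_inv[OF d] gen[OF inv])
    also have "\<dots> = inv (d s [^] n \<otimes> d g)"
      using central[OF g, of "d s [^] n"] evs.hom_closed[OF d] by simp
    also have "\<dots> = inv (d g) \<otimes> inv (d s) [^] n"
      using evs.hom_closed[OF d] evg.hom_closed[OF d] by (simp add: inv_mult_group int_pow_inv)
    finally show ?case by (simp only: evs.hom_inv[OF d] evg.hom_inv[OF d])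
  next
    case (eng d e)
    have d: "d \<in> carrier ?W" "e \<in> carrier ?W" using closed eng.hyps by auto
    have "d \<in> commutators ?W ?X" "e \<in> commutators ?W ?X" using sub eng.hyps by auto
    note central = word_map_central[OF this(1)] word_map_central[OF this(2)]
    note mem = evs.hom_closed[OF d(1)] evg.hom_closed[OF d(1)] evs.hom_closed[OF d(2)] evg.hom_closed[OF d(2)]
    have "(d \<otimes>\<^bsub>?W\<^esub> e) ?h = d g \<otimes> d s [^] n \<otimes> (e g \<otimes> e s [^] n)"
      by (simp only: evh.hom_mult[OF d] eng.IH)
    also have "\<dots> = d g \<otimes> (e g \<otimes> d s [^] n) \<otimes> e s [^] n"
      using central(2)[OF g, of "d s [^] n"] mem by (simp add: m_assoc)
    also have "\<dots> = (d g \<otimes> e g) \<otimes> (d s \<otimes> e s) [^] n"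
      using int_pow_mult_distrib[OF central(1)[OF s mem(3)] mem(1,3), of n] mem by (simp add: m_assoc)
    finally show ?case by (simp only: evs.hom_mult[OF d] evg.hom_mult[OF d])
  qed
qed

text \<open>Supplies the bound: these tuples are the domain of the injection in
  \<open>card_zeros_normal_form\<close>.\<close>

lemma card_tuples_zero_one:
  assumes "0 < k"
  shows "card {g \<in> tuples k. g 0 = \<one>} = card (carrier G) ^ (k - 1)"
proof -
  have "{g \<in> tuples k. g 0 = \<one>} = (\<Pi>\<^sub>E i\<in>{..<k}. if i = 0 then {\<one>} else carrier G)"
  proof (rule Set.set_eqI)
    fix g
    have *: "(\<forall>i\<in>{..<k}. g i \<in> carrier G) \<and> g 0 = \<one> \<longleftrightarrow>
        (\<forall>i\<in>{..<k}. g i \<in> (if i = 0 then {\<one>} else carrier G))"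
      using assms by (metis lessThan_iff one_closed singletonD singletonI)
    have "g \<in> {g \<in> tuples k. g 0 = \<one>} \<longleftrightarrow>
        ((\<forall>i\<in>{..<k}. g i \<in> carrier G) \<and> g 0 = \<one>) \<and> g \<in> extensional {..<k}"
      by (simp only: PiE_iff mem_Collect_eq conj_ac)
    then show "g \<in> {g \<in> tuples k. g 0 = \<one>} \<longleftrightarrow>
        g \<in> (\<Pi>\<^sub>E i\<in>{..<k}. if i = 0 then {\<one>} else carrier G)"
      by (simp only: * PiE_iff)
  qed
  also have "card \<dots> = (\<Prod>i<k. if i = 0 then 1 else card (carrier G))"
    by (simp add: card_PiE if_distrib cong: if_cong)
  also have "\<dots> = (\<Prod>i \<in> {..<k} - {0}. card (carrier G))"
    using assms by (subst prod.remove[of _ 0]) (auto intro!: prod.cong)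
  finally show ?thesis using assms by simp
qed

text \<open>Writing \<open>a = c g\<close>, which is central, replace the coordinate \<open>0\<close> of \<open>g\<close> by \<open>a\<close> and multiply the
  even coordinates by the power \<open>-1-m\<close> of a chosen preimage of \<open>a\<close> under \<open>c\<close> with the same odd
  coordinates. The value of \<open>c\<close> becomes \<open>a\<close> to the power \<open>-m\<close>, and \<open>g\<close> can be recovered.\<close>

lemma card_zeros_normal_form:
  assumes fin: "finite (carrier G)" and k: "0 < k"
    and c: "c \<in> class2_automorphisms.odd_commutators (word_maps k) (proj k) k"
  shows "card (carrier G) ^ (k - 1) \<le> card {g \<in> tuples k. g 0 [^] (m::int) \<otimes> c g = \<one>}"
proof -
  let ?W = "word_maps k" and ?X = "proj k ` {..<k}"
  interpret W: class2_automorphisms ?W "proj k" k "reparametrisations k"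
    by (rule word_maps_automorphisms)
  have X: "?X \<subseteq> carrier ?W" using proj_closed by blast
  have cX: "c \<in> commutators ?W ?X"
    using c W.mono_generate[of "{commutator ?W (proj k i) (proj k j) |i j. i < k \<and> j < k \<and> odd (i + j)}"
        "{commutator ?W x y |x y. x \<in> ?X \<and> y \<in> ?X}"]
    unfolding commutators_def W.odd_commutators_def by blast
  have cc: "c \<in> carrier ?W" using W.commutators_closed[OF X cX] .
  have cmem: "c g \<in> carrier G" if "g \<in> tuples k" for g
    using PiE_mem[of c "tuples k" "\<lambda>_. carrier G"] cc that by simp
  let ?T = "{g \<in> tuples k. g 0 = \<one>}"
  define Q where "Q g s \<longleftrightarrow> s \<in> ?T \<and> (\<forall>i<k. odd i \<longrightarrow> g i = s i) \<and> c s = c g" for g s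
  \<comment> \<open>\<open>Q g\<close>, and hence the choice, depends on \<open>g\<close> only
    through its odd coordinates and the value \<open>c g\<close>. Injectivity of
    \<open>\<Psi>\<close> rests on this.\<close>
  define \<sigma> where "\<sigma> g = (SOME s. Q g s)" for g
  have \<sigma>: "Q g (\<sigma> g)" if "g \<in> ?T" for g
    unfolding \<sigma>_def by (rule someI[of _ g]) (use that in \<open>simp add: Q_def\<close>)
  \<comment> \<open>Both \<open>g\<close> and \<open>\<sigma> g\<close> have \<open>\<one>\<close>
    at the even coordinate 0, so this factor makes \<open>\<Psi> g 0\<close> equal to
    \<open>c g\<close>.\<close>
  define z where "z g i = (if i = (0::nat) then c g else \<one>)" for g i
  define \<Psi> where "\<Psi> g = (\<lambda>i \<in> {..<k}. if odd i then g i else z g i \<otimes> g i \<otimes> \<sigma> g i [^] (- 1 - m))" for g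
  have inT: "g \<in> tuples k" "g 0 = \<one>" "\<sigma> g \<in> tuples k" "\<sigma> g 0 = \<one>" "c (\<sigma> g) = c g"
    "\<And>i. i < k \<Longrightarrow> odd i \<Longrightarrow> g i = \<sigma> g i"
    "\<And>i. i < k \<Longrightarrow> g i \<in> carrier G" "\<And>i. i < k \<Longrightarrow> \<sigma> g i \<in> carrier G"
    if "g \<in> ?T" for g
    using that \<sigma>[OF that] PiE_mem[of g "{..<k}" "\<lambda>_. carrier G"]
      PiE_mem[of "\<sigma> g" "{..<k}" "\<lambda>_. carrier G"] by (simp_all add: Q_def)
  have zc: "z g i \<in> carrier G" if "g \<in> ?T" for g i
    using cmem[OF inT(1)[OF that]] by (simp add: z_def)
  have zz: "z g i \<otimes> y = y \<otimes> z g i" if "g \<in> ?T" "y \<in> carrier G" for g i y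
    using word_map_central[OF cX inT(1)[OF that(1)] that(2)] that(2) by (simp add: z_def)
  have \<Psi>0: "\<Psi> g 0 = c g" if "g \<in> ?T" for g
    using inT[OF that] cmem k by (simp add: \<Psi>_def z_def)
  have \<Psi>mem: "\<Psi> g \<in> tuples k" if "g \<in> ?T" for g
    unfolding \<Psi>_def using inT[OF that] zc[OF that] by (intro restrict_PiE_iff[THEN iffD2]) simp
  have "\<Psi> ` ?T \<subseteq> {g \<in> tuples k. g 0 [^] m \<otimes> c g = \<one>}"
  proof (intro image_subsetI CollectI conjI)
    fix g assume g: "g \<in> ?T"
    show "\<Psi> g \<in> tuples k" using g by (rule \<Psi>mem)
    have "c (\<Psi> g) = c g \<otimes> c (\<sigma> g) [^] (- 1 - m)"
      unfolding \<Psi>_def by (rule odd_commutators_shift[OF c inT(1)[OF g] inT(3)[OF g] inT(6)[OF g] zc[OF g] zz[OF g]])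
    also have "\<dots> = c g [^] (1 :: int) \<otimes> c g [^] (- 1 - m)"
      using cmem[OF inT(1)[OF g]] by (simp add: inT(5)[OF g])
    also have "\<dots> = c g [^] (- m)"
      using int_pow_mult[OF cmem[OF inT(1)[OF g]], of 1 "- 1 - m"] by simp
    finally show "\<Psi> g 0 [^] m \<otimes> c (\<Psi> g) = \<one>"
      using cmem[OF inT(1)[OF g]] by (simp add: \<Psi>0[OF g] int_pow_neg)
  qed
  moreover have "inj_on \<Psi> ?T"
  proof (rule inj_onI)
    fix g h assume gh: "g \<in> ?T" "h \<in> ?T" "\<Psi> g = \<Psi> h"
    \<comment> \<open>Coordinate 0 of the image reveals \<open>c g\<close>, and the odd coordinates
      are copied unchanged. Together they determine \<open>\<sigma> g\<close>, after which the even
      coordinates follow by cancellation.\<close>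
    have "c g = c h" using \<Psi>0[OF gh(1)] \<Psi>0[OF gh(2)] gh(3) by simp
    moreover have odd: "g i = h i" if "i < k" "odd i" for i
      using fun_cong[OF gh(3), of i] that by (simp add: \<Psi>_def)
    ultimately have "Q g = Q h" by (auto simp: Q_def fun_eq_iff)
    then have \<sigma>gh: "\<sigma> g = \<sigma> h" by (simp add: \<sigma>_def)
    have zgh: "z g = z h" using \<open>c g = c h\<close> by (simp add: z_def fun_eq_iff)
    show "g = h"
    proof (rule PiE_ext[OF inT(1)[OF gh(1)] inT(1)[OF gh(2)]])
      fix i assume i: "i \<in> {..<k}"
      show "g i = h i"
      proof (cases "odd i")
        case True
        then show ?thesis using odd i by simp
      next
        case False
        then have "z h i \<otimes> g i \<otimes> \<sigma> h i [^] (- 1 - m) = z h i \<otimes> h i \<otimes> \<sigma> h i [^] (- 1 - m)"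
          using fun_cong[OF gh(3), of i] i by (simp add: \<Psi>_def \<sigma>gh zgh)
        then show ?thesis
          using inT(7,8)[OF gh(1)] inT(7,8)[OF gh(2)] zc[OF gh(2)] i by simp
      qed
    qed
  qed
  moreover have "finite {g \<in> tuples k. g 0 [^] m \<otimes> c g = \<one>}"
    using fin by (intro finite_subset[OF _ finite_PiE[of "{..<k}" "\<lambda>_. carrier G"]]) auto
  ultimately have "card ?T \<le> card {g \<in> tuples k. g 0 [^] m \<otimes> c g = \<one>}"
    by (intro card_inj_on_le[of \<Psi>])
  then show ?thesis using card_tuples_zero_one[OF k] by simp
qed

theorem card_zeros_word_map:
  assumes fin: "finite (carrier G)" and k: "0 < k"
    and u: "u \<in> generate (word_maps k) (proj k ` {..<k})"
  shows "card (carrier G) ^ (k - 1) \<le> card {g \<in> tuples k. u g = \<one>}"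
proof -
  let ?W = "word_maps k"
  interpret W: class2_automorphisms ?W "proj k" k "reparametrisations k"
    by (rule word_maps_automorphisms)
  have uc: "u \<in> carrier ?W"
    using u W.generate_in_carrier[of "proj k ` {..<k}"] proj_closed by blast
  obtain \<phi> m c where \<phi>: "\<phi> \<in> reparametrisations k" "c \<in> W.odd_commutators"
    "\<phi> u = proj k 0 [^]\<^bsub>?W\<^esub> (m::int) \<otimes>\<^bsub>?W\<^esub> c"
    using W.normal_form[OF k u] by blast
  have cc: "c \<in> carrier ?W"
    using subgroup.subset[OF W.odd_commutators_subgroup] \<phi>(2) by blast
  have "\<phi> u g = g 0 [^] m \<otimes> c g" if g: "g \<in> tuples k" for g
  proof -
    interpret ev: group_hom ?W G "\<lambda>u. u g" using g by (rule eval_hom)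
    show ?thesis
      using ev.hom_mult[OF W.int_pow_closed[OF proj_closed[OF k]] cc, of m]
        ev.hom_int_pow[OF proj_closed[OF k], of m] g by (simp only: \<phi>(3) proj_apply)
  qed
  then have "{g \<in> tuples k. \<phi> u g = \<one>} = {g \<in> tuples k. g 0 [^] m \<otimes> c g = \<one>}"
    by auto
  then show ?thesis
    using card_zeros_normal_form[OF fin k \<phi>(2), of m] card_zeros_reparametrisation[OF \<phi>(1) uc, of \<one>]
    by simp
qed

end

section \<open>Evaluation of pro-p words\<close>

lemma (in group) lower_central_closed: "lower_central G n \<subseteq> carrier G"
proof (induction n)
  case (Suc n)
  then show ?case
    unfolding lower_central.simps by (intro generate_incl) auto
qed simp

lemma (in group) class2_groupI:
  assumes "nilpotency_class_le G 2"
  shows "class2_group G"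
proof
  fix x y z assume xyz: "x \<in> carrier G" "y \<in> carrier G" "z \<in> carrier G"
  have "commutator G x y \<in> lower_central G 1"
    unfolding One_nat_def lower_central.simps commutator_def by (rule generate.incl) (use xyz in blast)
  then have "commutator G (commutator G x y) z \<in> lower_central G 2"
    unfolding numeral_2_eq_2 One_nat_def lower_central.simps(2)[of G "Suc 0"] commutator_def[of G _ z]
    by (intro generate.incl) (use xyz in blast)
  then have "commutator G (commutator G x y) z = \<one>"
    using assms by (simp add: nilpotency_class_le_def)
  then show "commutator G x y \<otimes> z = z \<otimes> commutator G x y"
    using commutator_mult[of "commutator G x y" z] xyz by simp
qed

text \<open>Surjectivity makes the generating commutators of each term images of those of the
  source, and images commute with \<open>generate\<close>. Used to carry the class bound to a copy
  of the group.\<close>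

lemma (in group_hom) lower_central_image:
  assumes "h ` carrier G = carrier H"
  shows "lower_central H n = h ` lower_central G n"
proof (induction n)
  case 0
  then show ?case using assms by simp
next
  case (Suc n)
  let ?S = "\<lambda>K A. \<Union>a\<in>A. \<Union>b\<in>carrier K. {a \<otimes>\<^bsub>K\<^esub> b \<otimes>\<^bsub>K\<^esub> inv\<^bsub>K\<^esub> a \<otimes>\<^bsub>K\<^esub> inv\<^bsub>K\<^esub> b}"
  have sub: "lower_central G n \<subseteq> carrier G" by (rule G.lower_central_closed)
  have "?S H (h ` lower_central G n) = (\<Union>a\<in>lower_central G n. \<Union>b\<in>carrier G.
      {h a \<otimes>\<^bsub>H\<^esub> h b \<otimes>\<^bsub>H\<^esub> inv\<^bsub>H\<^esub> h a \<otimes>\<^bsub>H\<^esub> inv\<^bsub>H\<^esub> h b})"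
    unfolding assms[symmetric] by simp
  also have "\<dots> = (\<Union>a\<in>lower_central G n. \<Union>b\<in>carrier G. {h (a \<otimes> b \<otimes> inv a \<otimes> inv b)})"
    using sub by (intro SUP_cong refl) (simp add: subset_iff)
  also have "\<dots> = h ` ?S G (lower_central G n)" by blast
  finally have "?S H (lower_central H n) = h ` ?S G (lower_central G n)" by (simp only: Suc)
  moreover have "?S G (lower_central G n) \<subseteq> carrier G" using sub by auto
  ultimately show ?case using generate_img by simp
qed

section \<open>Evaluation at a tuple of a finite group of arbitrary carrier type\<close>

lemma (in group) weak_group_morphism_inj:
  assumes "inj_on f (carrier G)"
  shows "weak_group_morphism f {\<one>} G"
proof (rule weak_group_morphismsI[OF one_is_normal])
  fix a b assume "a \<in> carrier G" "b \<in> carrier G"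
  then show "f a = f b \<longleftrightarrow> a \<otimes> inv b \<in> {\<one>}"
    using assms inv_solve_right'[of \<one> a b] by (auto simp: inj_on_eq_iff)
qed

text \<open>The universal property of \<open>F\<close> speaks of test groups on \<open>nat\<close>.
  So \<open>G\<close> is copied along an injection into \<open>nat\<close>, the homomorphism is
  obtained for the copy, and it is carried back by the inverse isomorphism.\<close>

lemma continuous_homs_exist:
  fixes G :: "('a, 'b) monoid_scheme"
  assumes F: "free_pro_p_group_class2 p k F T x"
    and G: "finite_p_group p G" "nilpotency_class_le G 2"
    and g: "g \<in> {..<k} \<rightarrow>\<^sub>E carrier G"
  shows "\<exists>\<phi> \<in> continuous_homs F T G. \<forall>i<k. \<phi> (x i) = g i"
proof -
  interpret G: group G using G(1) by (simp add: finite_p_group_def)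
  have fin: "finite (carrier G)" using G(1) by (simp add: finite_p_group_def)
  have F': "group F" "topspace T = carrier F" "\<And>i. i < k \<Longrightarrow> x i \<in> carrier F"
    using F by (auto simp: free_pro_p_group_class2_def pro_p_group_def topological_group_def)
  have g': "g i \<in> carrier G" if "i < k" for i using PiE_mem[OF g] that by simp
  obtain f :: "'a \<Rightarrow> nat" where f: "inj_on f (carrier G)"
    using finite_imp_inj_to_nat_seg[OF fin] by blast
  define H where "H = image_group f G"
  define f' where "f' = inv_into (carrier G) f"
  have weak: "weak_group_morphism f {\<one>\<^bsub>G\<^esub>} G" using f by (rule G.weak_group_morphism_inj)
  interpret f: group_hom G H f
    unfolding H_def using weak by (rule G.weak_group_morphism_group_hom)
  have carH: "carrier H = f ` carrier G" by (simp add: H_def image_group_carrier)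
  have bij: "bij_betw f (carrier G) (carrier H)" using f by (simp add: bij_betw_def carH)
  have H1: "finite_p_group p H"
    using G(1) bij_betw_same_card[OF bij] f.H.is_group fin by (auto simp: finite_p_group_def carH)
  have H2: "nilpotency_class_le H 2"
    using G(2) f.lower_central_image[OF carH[symmetric], of 2] f.hom_one by (simp add: nilpotency_class_le_def)
  have H3: "(f \<circ> g) ` {..<k} \<subseteq> carrier H"
    using g' by (auto simp: carH)
  have imp: "finite_p_group p H \<and> nilpotency_class_le H 2 \<and> (f \<circ> g) ` {..<k} \<subseteq> carrier H \<longrightarrow>
      (\<exists>\<phi> \<in> continuous_homs F T H. \<forall>i<k. \<phi> (x i) = (f \<circ> g) i)"
    using F unfolding free_pro_p_group_class2_def by (elim conjE allE[of _ H] allE[of _ "f \<circ> g"])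
  have "\<exists>\<phi> \<in> continuous_homs F T H. \<forall>i<k. \<phi> (x i) = (f \<circ> g) i"
    by (rule mp[OF imp]) (intro conjI H1 H2 H3)
  then obtain \<phi> where \<phi>: "\<phi> \<in> continuous_homs F T H" "\<And>i. i < k \<Longrightarrow> \<phi> (x i) = (f \<circ> g) i"
    by blast
  have \<phi>': "\<phi> \<in> hom F H" "continuous_map T (discrete_topology (carrier H)) \<phi>"
    using \<phi>(1) by (simp_all add: continuous_homs_def)
  have f'hom: "f' \<in> hom H G"
    using G.iso_set_sym[of f H] bij f.homh by (simp add: iso_def f'_def)
  have f'H: "f' y \<in> carrier G" if "y \<in> carrier H" for y
    using f'hom that by (rule hom_in_carrier)
  have hom: "f' \<circ> \<phi> \<in> hom F G" using \<phi>'(1) f'hom by (rule Group.hom_compose)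
  \<comment> \<open>Restriction to the carrier provides the extensionality that
    \<open>continuous_homs\<close> demands.\<close>
  define \<psi> where "\<psi> = restrict (f' \<circ> \<phi>) (carrier F)"
  have "\<psi> \<in> hom F G"
    unfolding \<psi>_def using group.hom_restrict[OF F'(1) hom] by simp
  moreover have "continuous_map T (discrete_topology (carrier G)) \<psi>"
  proof (rule continuous_map_eq)
    show "continuous_map T (discrete_topology (carrier G)) (f' \<circ> \<phi>)"
      using \<phi>'(2) by (rule continuous_map_compose) (use f'H in simp)
  qed (simp add: \<psi>_def F'(2))
  ultimately have "\<psi> \<in> continuous_homs F T G"
    by (simp add: continuous_homs_def \<psi>_def)
  moreover have "\<psi> (x i) = g i" if "i < k" for i
    using that F'(3) \<phi>(2) g' f by (simp add: \<psi>_def f'_def)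
  ultimately show ?thesis by blast
qed

section \<open>Density of the abstract words\<close>

text \<open>The target is discrete, so each condition \<open>\<phi> v = \<phi> w\<close> defines an
  open neighbourhood of \<open>w\<close>. Finitely many of them intersect in an open set, which
  meets the dense set \<open>S\<close>.\<close>

lemma dense_simultaneous_value:
  assumes F: "topspace T = carrier F" "Abstract_Topology.closure_of T S = carrier F" and w: "w \<in> carrier F"
    and \<Phi>: "finite \<Phi>" "\<Phi> \<subseteq> continuous_homs F T G"
  shows "\<exists>v \<in> S. \<forall>\<phi> \<in> \<Phi>. \<phi> v = \<phi> w"
proof -
  \<comment> \<open>The intersection with \<open>topspace T\<close> keeps \<open>U\<close> inside
    the space even for empty \<open>\<Phi>\<close>.\<close>
  define U where "U = (\<Inter>\<phi> \<in> \<Phi>. {v \<in> topspace T. \<phi> v \<in> {\<phi> w}}) \<inter> topspace T"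
  have "openin T U"
    unfolding U_def
  proof (rule openin_INT[OF \<Phi>(1)])
    fix \<phi> assume "\<phi> \<in> \<Phi>"
    then have "\<phi> \<in> hom F G" "continuous_map T (discrete_topology (carrier G)) \<phi>"
      using \<Phi>(2) by (auto simp: continuous_homs_def)
    then show "openin T {v \<in> topspace T. \<phi> v \<in> {\<phi> w}}"
      using w by (intro openin_continuous_map_preimage) (auto intro: hom_in_carrier)
  qed
  moreover have "w \<in> Abstract_Topology.closure_of T S" using F(2) w by simp
  moreover have "w \<in> U" using w F(1) by (simp add: U_def)
  ultimately obtain v where v: "v \<in> S" "v \<in> U"
    by (auto simp: in_closure_of)
  have "\<phi> v = \<phi> w" if "\<phi> \<in> \<Phi>" for \<phi>
    using v(2) that by (simp add: U_def)
  with v(1) show ?thesis by (intro bexI[of _ v]) simp_all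
qed

text \<open>Agreement on \<open>X\<close> extends to the generated subgroup. By density that
  subgroup has, for each \<open>w\<close>, an element at which both homomorphisms take the values
  they have at \<open>w\<close>.\<close>

lemma continuous_homs_eqI:
  assumes F: "group F" "topspace T = carrier F" "Abstract_Topology.closure_of T (generate F X) = carrier F" "X \<subseteq> carrier F"
    and G: "group G" and \<phi>: "\<phi> \<in> continuous_homs F T G" "\<psi> \<in> continuous_homs F T G"
    and eq: "\<And>y. y \<in> X \<Longrightarrow> \<phi> y = \<psi> y"
  shows "\<phi> = \<psi>"
proof -
  have hom: "\<phi> \<in> hom F G" "\<psi> \<in> hom F G" "\<phi> \<in> extensional (carrier F)" "\<psi> \<in> extensional (carrier F)"
    using \<phi> by (simp_all add: continuous_homs_def)
  interpret \<phi>: group_hom F G \<phi> using F(1) G hom(1) by (simp add: group_hom_def group_hom_axioms_def)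
  interpret \<psi>: group_hom F G \<psi> using F(1) G hom(2) by (simp add: group_hom_def group_hom_axioms_def)
  have gen: "\<phi> v = \<psi> v" if "v \<in> generate F X" for v
    using that
  proof induction
    case (inv h)
    then have "h \<in> carrier F" using F(4) by blast
    then show ?case using eq[OF inv] by simp
  next
    case (eng h1 h2)
    then have "h1 \<in> carrier F" "h2 \<in> carrier F"
      using \<phi>.G.generate_in_carrier[OF F(4)] by simp_all
    then show ?case using eng.IH by simp
  qed (simp_all add: eq)
  show ?thesis
  proof (rule extensionalityI[OF hom(3,4)])
    fix w assume w: "w \<in> carrier F"
    obtain v where v: "v \<in> generate F X" "\<forall>\<rho> \<in> {\<phi>, \<psi>}. \<rho> v = \<rho> w"
      using dense_simultaneous_value[OF F(2,3) w, of "{\<phi>, \<psi>}" G] \<phi> by auto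
    then have "\<phi> v = \<phi> w" "\<psi> v = \<psi> w" by blast+
    with gen[OF v(1)] show "\<phi> w = \<psi> w" by simp
  qed
qed

theorem theorem2p4:
  fixes G :: "('a, 'b) monoid_scheme"
    and F :: "('f, 'e) monoid_scheme"
    and T :: "'f topology"
    and x :: "nat \<Rightarrow> 'f"
    and w :: 'f
    and p k :: nat
  assumes "prime p"
    and "finite_p_group p G"
    and "has_nilpotency_class G 2"
    and "k \<ge> 1"
    and "free_pro_p_group_class2 p k F T x"
    and "w \<in> carrier F"
  shows "word_count k F T x w G \<one>\<^bsub>G\<^esub> \<ge> card (carrier G) ^ (k - 1)"
proof -
  have G: "group G" "finite (carrier G)" using assms(2) by (simp_all add: finite_p_group_def)
  have cl: "nilpotency_class_le G 2" using assms(3) by (simp add: has_nilpotency_class_def)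
  interpret class2_group G using group.class2_groupI[OF G(1) cl] .
  have F: "group F" "topspace T = carrier F" "Abstract_Topology.closure_of T (generate F (x ` {..<k})) = carrier F"
    "x ` {..<k} \<subseteq> carrier F"
    using assms(5) by (simp_all add: free_pro_p_group_class2_def pro_p_group_def topological_group_def)
  \<comment> \<open>The description used in \<open>word_value\<close>; \<open>ex1\<close> ensures
    that it denotes the intended homomorphism.\<close>
  define ev where "ev g = (THE \<phi>. \<phi> \<in> continuous_homs F T G \<and> (\<forall>i<k. \<phi> (x i) = g i))" for g
  have ex1: "\<exists>!\<phi>. \<phi> \<in> continuous_homs F T G \<and> (\<forall>i<k. \<phi> (x i) = g i)" if "g \<in> tuples k" for g
  proof (rule ex_ex1I)
    show "\<exists>\<phi>. \<phi> \<in> continuous_homs F T G \<and> (\<forall>i<k. \<phi> (x i) = g i)"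
      using continuous_homs_exist[OF assms(5,2) cl that] by blast
    show "\<phi> = \<psi>" if "\<phi> \<in> continuous_homs F T G \<and> (\<forall>i<k. \<phi> (x i) = g i)"
      "\<psi> \<in> continuous_homs F T G \<and> (\<forall>i<k. \<psi> (x i) = g i)" for \<phi> \<psi>
      using that by (intro continuous_homs_eqI[OF F G(1)]) auto
  qed
  have ev: "ev g \<in> continuous_homs F T G \<and> (\<forall>i<k. ev g (x i) = g i)" if "g \<in> tuples k" for g
    unfolding ev_def by (rule theI'[OF ex1[OF that]])
  have hom: "ev g \<in> hom F G" if "g \<in> tuples k" for g
    using ev[OF that] by (simp add: continuous_homs_def)
  have "finite (ev ` tuples k)" using G(2) by (intro finite_imageI finite_PiE) auto
  moreover have "ev ` tuples k \<subseteq> continuous_homs F T G"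
    by (rule image_subsetI) (rule conjunct1[OF ev])
  \<comment> \<open>There are only finitely many tuples, so one abstract word \<open>v\<close> has
    the same value as \<open>w\<close> at all of them.\<close>
  ultimately obtain v where v: "v \<in> generate F (x ` {..<k})" "\<forall>\<rho> \<in> ev ` tuples k. \<rho> v = \<rho> w"
    using dense_simultaneous_value[OF F(2,3) assms(6), of "ev ` tuples k" G] by auto
  have vw: "ev g v = ev g w" if "g \<in> tuples k" for g
    using bspec[OF v(2) imageI[OF that]] .
  \<comment> \<open>All evaluations together form one homomorphism into the word maps that sends
    \<open>x i\<close> to \<open>proj k i\<close>. Hence \<open>\<theta> v\<close> lies in the
    subgroup generated by the projections, as \<open>card_zeros_word_map\<close> requires.\<close>
  define \<theta> where "\<theta> y = (\<lambda>g \<in> tuples k. ev g y)" for y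
  have "\<theta> \<in> hom F (word_maps k)"
  proof (rule homI)
    fix y z assume y: "y \<in> carrier F" and z: "z \<in> carrier F"
    show "\<theta> y \<in> carrier (word_maps k)"
      unfolding \<theta>_def carrier_product_group
      using hom_in_carrier[OF hom y] by (intro restrict_PiE_iff[THEN iffD2]) simp
    show "\<theta> (y \<otimes>\<^bsub>F\<^esub> z) = \<theta> y \<otimes>\<^bsub>word_maps k\<^esub> \<theta> z"
      unfolding \<theta>_def mult_product_group
      using hom_mult[OF hom y z] by (intro restrict_ext) simp
  qed
  then interpret \<theta>: group_hom F "word_maps k" \<theta>
    using F(1) word_maps_group[of k] by (simp add: group_hom_def group_hom_axioms_def)
  have "\<theta> (x i) = proj k i" if "i < k" for i
    unfolding \<theta>_def proj_def using ev that by (intro restrict_ext) simp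
  then have "\<theta> ` x ` {..<k} = proj k ` {..<k}" by (simp add: image_image)
  then have "\<theta> v \<in> generate (word_maps k) (proj k ` {..<k})"
    using \<theta>.generate_img[OF F(4)] v(1) by auto
  then have "card (carrier G) ^ (k - 1) \<le> card {g \<in> tuples k. \<theta> v g = \<one>\<^bsub>G\<^esub>}"
    using assms(4) by (intro card_zeros_word_map[OF G(2)]) auto
  also have "{g \<in> tuples k. \<theta> v g = \<one>\<^bsub>G\<^esub>} = {g \<in> tuples k. word_value k F T x w G g = \<one>\<^bsub>G\<^esub>}"
    using vw by (intro Collect_cong conj_cong refl) (simp add: \<theta>_def word_value_def ev_def)
  finally show ?thesis by (simp add: word_count_def)
qed

end
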